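(* Let $\Gamma$ be a multi-set of H-$ILL^{mix}$ Horn formulae and $Z$ a positive tensor product or empty. Then $\Gamma\vdash Z$ is an honoured sequent if and only if the contract automaton $\llbracket\Gamma\rrbracket$ admits agreement on $Z$.
   Context: Contract automata: fix disjoint sets $\mathbb{R}$ (requests $a$) and $\mathbb{O}$ (offers $\overline a$), idle symbol $\Box$, $co$ swapping $a,\overline a$. Vectors over $\mathbb{R}\cup\mathbb{O}\cup\{\Box\}$: request/offer on $\alpha$ = $\Box^{n_1}\alpha\Box^{n_2}$ with $\alpha$ a request/offer; match = $\Box^{n_1}\alpha\Box^{n_2}co(\alpha)\Box^{n_3}$; $\vec a\bowtie\vec b$ iff $\vec a$ is a request or offer on some $\alpha$ and $\vec b$ is respectively an offer or request on $co(\alpha)$. A CA of rank $n$ is $\langle Q,\vec q_0,A^r,A^o,T,F\rangle$, $Q=Q_1\times\cdots\times Q_n$, transition labels being requests, offers or matches, idle components not changing state; its language is the set of label words of paths from $\vec q_0$ to $F$. Product of CAs: states are concatenations, initial/final componentwise, transitions are either a joint move of two components with complementary labels (label padded by idles) or a move of a single component padded by idles, allowed only if no other component has, in its current state, a transition with complementary label. $\boxtimes$ (a-product) is the product of all rank-1 projections of the operands. Concatenation of rank-1 CAs $\mathcal{A}^1\cdot\mathcal{A}^2=\langle Q^1\cup Q^2,q^1_0,A^{r1}\cup A^{r2},A^{o1}\cup A^{o2},(T^1\setminus\{(q,a,q')\in T^1\mid q'\in F^1\})\cup T^2\cup\{(q,a,q^2_0)\mid(q,a,q')\in T^1,q'\in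 F^1\},F^2\rangle$. H-$ILL^{mix}$: positive atoms $\mathbf{A}$ ($a,b,\ldots$), negative atoms $a^\bot$, literals $\mathbf{L}$. Formulae $p::=\bigotimes_{i\in I}\alpha_i$, clauses $\alpha::=\bigotimes_{a\in X}a\mid\bigotimes_{b\in Y}b\multimap\bigotimes_{a\in X}a$ with $|I|\ge2$, $|X|,|Y|\ge1$, $X\subseteq\mathbf{L}$ not containing both $a$ and $a^\bot$, $Y\subseteq\mathbf{A}$, and $b\in Y\Rightarrow b\notin X$. Translation, with $P=\{q\cup\{\ast\}\mid q\subseteq X\}$: $\llbracket\bigotimes_i\alpha_i\rrbracket=\boxtimes_i\llbracket\alpha_i\rrbracket$; $\llbracket\bigotimes_{a\in X}a\rrbracket=\langle P,X\cup\{\ast\},\{a\mid a^\bot\in X\},\{\overline a\mid a\in X\cap\mathbf{A}\},\{(Z'\cup\{a^\bot\},a,Z')\mid Z'\cup\{a^\bot\}\in P,a^\bot\in X\}\cup\{(Z'\cup\{a\},\overline a,Z')\mid Z'\cup\{a\}\in P,a\in X\},\{\{\ast\}\}\rangle$ (with the removed literal not in $Z'$); $\llbracket\bigotimes_{b\in Y}b\multimap\bigotimes_{a\in X}a\rrbracket=\llbracket\bigotimes_{b\in Y}b^\bot\rrbracket\cdot\llbracket\bigotimes_{a\in X}a\rrbracket$; for multisets $\llbracket p,\Gamma\rrbracket=\llbracket p\rrbracket\boxtimes\llbracket\Gamma\rrbracket$ and $\llbracket\alpha,\Gamma\rrbracket=\llbracket\alpha\rrbracket\boxtimes\llbracket\Gamma\rrbracket$.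 $\llbracket\Gamma\rrbracket$ admits agreement on $Z$ iff some word of its language consists only of match actions and of offer actions in correspondence with the literals of $Z$. A positive tensor product is a tensor product of positive atoms. $\Gamma\vdash Z$ is honoured iff it is provable in $ILL^{mix}$ and $Z$ is a positive tensor product or empty. $ILL^{mix}$ sequent calculus ($\Gamma,\Gamma'$ multisets, $\gamma$ a formula or empty): $Ax$: $A\vdash A$; $Mix$: from $\Gamma\vdash$ and $\Gamma'\vdash\gamma$ infer $\Gamma,\Gamma'\vdash\gamma$; $NegL$: from $\Gamma\vdash A$ infer $\Gamma,A^\bot\vdash$; $NegR$: from $\Gamma,A\vdash$ infer $\Gamma\vdash A^\bot$; $\otimes L$: from $\Gamma,A,B\vdash\gamma$ infer $\Gamma,A\otimes B\vdash\gamma$; $\otimes R$: from $\Gamma\vdash A$, $\Gamma'\vdash B$ infer $\Gamma,\Gamma'\vdash A\otimes B$; $\multimap L$: from $\Gamma\vdash A$, $\Gamma',B\vdash\gamma$ infer $\Gamma,\Gamma',A\multimap B\vdash\gamma$; $\multimap R$: from $\Gamma,A\vdash B$ infer $\Gamma\vdash A\multimap B$; $Cut$: from $\Gamma\vdash A$, $\Gamma',A\vdash\gamma$ infer $\Gamma,\Gamma'\vdash\gamma$; $\bot R$: from $\Gamma\vdash$ infer $\Gamma\vdash\bot$; $\bot L$: $\bot\vdash$; $1R$: $\vdash1$; $1L$: from $\Gamma\vdash\gamma$ infer $\Gamma,1\vdash\gamma$; $\top$: $\Gamma\vdash\top$; $0L$: $\Gamma,0\vdash A$; $\oplus L$: from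 $\Gamma,A\vdash\gamma$, $\Gamma,B\vdash\gamma$ infer $\Gamma,A\oplus B\vdash\gamma$; $\oplus R1/2$: from $\Gamma\vdash A$ (resp. $B$) infer $\Gamma\vdash A\oplus B$; $\& R$: from $\Gamma\vdash A$, $\Gamma\vdash B$ infer $\Gamma\vdash A\& B$; $\& L1/2$: from $\Gamma,A\vdash\gamma$ (resp. $\Gamma,B\vdash\gamma$) infer $\Gamma,A\& B\vdash\gamma$; $!L$: from $\Gamma,A\vdash\gamma$ infer $\Gamma,!A\vdash\gamma$; $!R$: from $!\Gamma\vdash A$ infer $!\Gamma\vdash!A$; $weakL$: from $\Gamma\vdash\gamma$ infer $\Gamma,!A\vdash\gamma$; $coL$: from $\Gamma,!A,!A\vdash\gamma$ infer $\Gamma,!A\vdash\gamma$.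
   Formalization: State sets are made disjoint before concatenation: with the plain union, b, b⊸b^⊥ admits agreement on empty though b, b⊸b^⊥ ⊢ is not provable. The translation of the empty multiset, undefined in the source, is taken to be the automaton with empty language. *)

theory Defs
  imports "HOL-Library.Multiset"
begin

section \<open>Contract automata\<close>

datatype 'a action = Req 'a | Off 'a | Idle

fun co :: "'a action \<Rightarrow> 'a action" where
  "co (Req a) = Off a"
| "co (Off a) = Req a"
| "co Idle = Idle"

type_synonym 'a label = "'a action list"

definition request_on :: "'a action \<Rightarrow> 'a label \<Rightarrow> bool" where
  "request_on \<alpha> v \<longleftrightarrow> (\<exists>a. \<alpha> = Req a) \<and>
     (\<exists>n1 n2. v = replicate n1 Idle @ [\<alpha>] @ replicate n2 Idle)"

definition offer_on :: "'a action \<Rightarrow> 'a label \<Rightarrow> bool" where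
  "offer_on \<alpha> v \<longleftrightarrow> (\<exists>a. \<alpha> = Off a) \<and>
     (\<exists>n1 n2. v = replicate n1 Idle @ [\<alpha>] @ replicate n2 Idle)"

definition match_label :: "'a label \<Rightarrow> bool" where
  "match_label v \<longleftrightarrow> (\<exists>\<alpha> n1 n2 n3. \<alpha> \<noteq> Idle \<and>
     v = replicate n1 Idle @ [\<alpha>] @ replicate n2 Idle @ [co \<alpha>] @ replicate n3 Idle)"

definition complementary :: "'a label \<Rightarrow> 'a label \<Rightarrow> bool" (infix "\<bowtie>" 50) where
  "v \<bowtie> w \<longleftrightarrow> (\<exists>\<alpha>. request_on \<alpha> v \<and> offer_on (co \<alpha>) w \<or> offer_on \<alpha> v \<and> request_on (co \<alpha>) w)"

text \<open>
  A state of a contract automaton of rank \<open>n\<close> is the list of length \<open>n\<close> of the states of its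
  principals, a label is a list of \<open>n\<close> actions.
\<close>

record ('s, 'a) ca =
  ca_rank :: nat
  ca_states :: "'s list set"
  ca_init :: "'s list"
  ca_requests :: "'a action set"
  ca_offers :: "'a action set"
  ca_trans :: "('s list \<times> 'a label \<times> 's list) set"
  ca_final :: "'s list set"

inductive ca_path :: "('s, 'a) ca \<Rightarrow> 's list \<Rightarrow> 'a label list \<Rightarrow> 's list \<Rightarrow> bool"
  for A :: "('s, 'a) ca" where
  path_Nil: "q \<in> ca_states A \<Longrightarrow> ca_path A q [] q"
| path_Cons: "(q, v, q') \<in> ca_trans A \<Longrightarrow> ca_path A q' w q'' \<Longrightarrow> ca_path A q (v # w) q''"

definition ca_language :: "('s, 'a) ca \<Rightarrow> 'a label list set" where
  "ca_language A = {w. \<exists>q \<in> ca_final A. ca_path A (ca_init A) w q}"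

text \<open>
  Component states are kept apart as a list of lists, whose concatenation is the product state;
  \<open>ca_idles As\<close> is the all-idle label, cut into one block per operand.
\<close>

definition ca_idles :: "('s, 'a) ca list \<Rightarrow> 'a label list" where
  "ca_idles As = map (\<lambda>A. replicate (ca_rank A) Idle) As"

definition ca_product :: "('s, 'a) ca list \<Rightarrow> ('s, 'a) ca" where
  "ca_product As = \<lparr>
     ca_rank = sum_list (map ca_rank As),
     ca_states = concat ` listset (map ca_states As),
     ca_init = concat (map ca_init As),
     ca_requests = (\<Union>A \<in> set As. ca_requests A),
     ca_offers = (\<Union>A \<in> set As. ca_offers A),
     ca_trans =
       {(concat qs, concat ((ca_idles As)[i := v, j := w]), concat (qs[i := q', j := r']))
         | qs i j v w q' r'.
           qs \<in> listset (map ca_states As) \<and> i < j \<and> j < length As \<and>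
           (qs ! i, v, q') \<in> ca_trans (As ! i) \<and> (qs ! j, w, r') \<in> ca_trans (As ! j) \<and> v \<bowtie> w}
       \<union> {(concat qs, concat ((ca_idles As)[i := v]), concat (qs[i := q'])) | qs i v q'.
           qs \<in> listset (map ca_states As) \<and> i < length As \<and>
           (qs ! i, v, q') \<in> ca_trans (As ! i) \<and>
           (\<forall>j < length As. j \<noteq> i \<longrightarrow> \<not> (\<exists>w r'. (qs ! j, w, r') \<in> ca_trans (As ! j) \<and> v \<bowtie> w))},
     ca_final = concat ` listset (map ca_final As) \<rparr>"

definition ca_proj_trans ::
  "('s, 'a) ca \<Rightarrow> nat \<Rightarrow> ('s list \<times> 'a label \<times> 's list) set" where
  "ca_proj_trans A i = {([q ! i], [v ! i], [q' ! i]) | q v q'. (q, v, q') \<in> ca_trans A \<and> v ! i \<noteq> Idle}"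

definition ca_proj :: "('s, 'a) ca \<Rightarrow> nat \<Rightarrow> ('s, 'a) ca" where
  "ca_proj A i = \<lparr>
     ca_rank = 1,
     ca_states = (\<lambda>q. [q ! i]) ` ca_states A,
     ca_init = [ca_init A ! i],
     ca_requests = {\<alpha> \<in> ca_requests A. \<exists>q q'. (q, [\<alpha>], q') \<in> ca_proj_trans A i},
     ca_offers = {\<alpha> \<in> ca_offers A. \<exists>q q'. (q, [\<alpha>], q') \<in> ca_proj_trans A i},
     ca_trans = ca_proj_trans A i,
     ca_final = (\<lambda>q. [q ! i]) ` ca_final A \<rparr>"

definition ca_aproduct :: "('s, 'a) ca list \<Rightarrow> ('s, 'a) ca" where
  "ca_aproduct As = ca_product (concat (map (\<lambda>A. map (ca_proj A) [0..<ca_rank A]) As))"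

definition ca_concat :: "('s, 'a) ca \<Rightarrow> ('s, 'a) ca \<Rightarrow> ('s, 'a) ca" where
  "ca_concat A B = \<lparr>
     ca_rank = 1,
     ca_states = ca_states A \<union> ca_states B,
     ca_init = ca_init A,
     ca_requests = ca_requests A \<union> ca_requests B,
     ca_offers = ca_offers A \<union> ca_offers B,
     ca_trans = (ca_trans A - {(q, v, q') \<in> ca_trans A. q' \<in> ca_final A}) \<union> ca_trans B
       \<union> {(q, v, ca_init B) | q v q'. (q, v, q') \<in> ca_trans A \<and> q' \<in> ca_final A},
     ca_final = ca_final B \<rparr>"

definition ca_rename :: "('s \<Rightarrow> 't) \<Rightarrow> ('s, 'a) ca \<Rightarrow> ('t, 'a) ca" where
  "ca_rename f A = \<lparr>
     ca_rank = ca_rank A,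
     ca_states = map f ` ca_states A,
     ca_init = map f (ca_init A),
     ca_requests = ca_requests A,
     ca_offers = ca_offers A,
     ca_trans = (\<lambda>(q, v, q'). (map f q, v, map f q')) ` ca_trans A,
     ca_final = map f ` ca_final A \<rparr>"


section \<open>Intuitionistic linear logic with Mix\<close>

datatype 'a form =
    Atom 'a
  | Neg "'a form"
  | Tensor "'a form" "'a form"
  | Limp "'a form" "'a form"
  | One
  | Bot
  | Top
  | Zero
  | Plus "'a form" "'a form"
  | With "'a form" "'a form"
  | Bang "'a form"

text \<open>The right-hand side of a sequent is a formula or empty (\<open>None\<close>).\<close>

inductive ill_mix :: "'a form multiset \<Rightarrow> 'a form option \<Rightarrow> bool" (infix "\<turnstile>" 45) where
  Ax: "{#A#} \<turnstile> Some A"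
| Mix: "\<Gamma> \<turnstile> None \<Longrightarrow> \<Gamma>' \<turnstile> \<gamma> \<Longrightarrow> \<Gamma> + \<Gamma>' \<turnstile> \<gamma>"
| NegL: "\<Gamma> \<turnstile> Some A \<Longrightarrow> \<Gamma> + {#Neg A#} \<turnstile> None"
| NegR: "\<Gamma> + {#A#} \<turnstile> None \<Longrightarrow> \<Gamma> \<turnstile> Some (Neg A)"
| TensorL: "\<Gamma> + {#A, B#} \<turnstile> \<gamma> \<Longrightarrow> \<Gamma> + {#Tensor A B#} \<turnstile> \<gamma>"
| TensorR: "\<Gamma> \<turnstile> Some A \<Longrightarrow> \<Gamma>' \<turnstile> Some B \<Longrightarrow> \<Gamma> + \<Gamma>' \<turnstile> Some (Tensor A B)"
| LimpL: "\<Gamma> \<turnstile> Some A \<Longrightarrow> \<Gamma>' + {#B#} \<turnstile> \<gamma> \<Longrightarrow> \<Gamma> + \<Gamma>' + {#Limp A B#} \<turnstile> \<gamma>"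
| LimpR: "\<Gamma> + {#A#} \<turnstile> Some B \<Longrightarrow> \<Gamma> \<turnstile> Some (Limp A B)"
| Cut: "\<Gamma> \<turnstile> Some A \<Longrightarrow> \<Gamma>' + {#A#} \<turnstile> \<gamma> \<Longrightarrow> \<Gamma> + \<Gamma>' \<turnstile> \<gamma>"
| BotR: "\<Gamma> \<turnstile> None \<Longrightarrow> \<Gamma> \<turnstile> Some Bot"
| BotL: "{#Bot#} \<turnstile> None"
| OneR: "{#} \<turnstile> Some One"
| OneL: "\<Gamma> \<turnstile> \<gamma> \<Longrightarrow> \<Gamma> + {#One#} \<turnstile> \<gamma>"
| TopR: "\<Gamma> \<turnstile> Some Top"
| ZeroL: "\<Gamma> + {#Zero#} \<turnstile> Some A"
| PlusL: "\<Gamma> + {#A#} \<turnstile> \<gamma> \<Longrightarrow> \<Gamma> + {#B#} \<turnstile> \<gamma> \<Longrightarrow> \<Gamma> + {#Plus A B#} \<turnstile> \<gamma>"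
| PlusR1: "\<Gamma> \<turnstile> Some A \<Longrightarrow> \<Gamma> \<turnstile> Some (Plus A B)"
| PlusR2: "\<Gamma> \<turnstile> Some B \<Longrightarrow> \<Gamma> \<turnstile> Some (Plus A B)"
| WithR: "\<Gamma> \<turnstile> Some A \<Longrightarrow> \<Gamma> \<turnstile> Some B \<Longrightarrow> \<Gamma> \<turnstile> Some (With A B)"
| WithL1: "\<Gamma> + {#A#} \<turnstile> \<gamma> \<Longrightarrow> \<Gamma> + {#With A B#} \<turnstile> \<gamma>"
| WithL2: "\<Gamma> + {#B#} \<turnstile> \<gamma> \<Longrightarrow> \<Gamma> + {#With A B#} \<turnstile> \<gamma>"
| BangL: "\<Gamma> + {#A#} \<turnstile> \<gamma> \<Longrightarrow> \<Gamma> + {#Bang A#} \<turnstile> \<gamma>"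
| BangR: "image_mset Bang \<Gamma> \<turnstile> Some A \<Longrightarrow> image_mset Bang \<Gamma> \<turnstile> Some (Bang A)"
| WeakL: "\<Gamma> \<turnstile> \<gamma> \<Longrightarrow> \<Gamma> + {#Bang A#} \<turnstile> \<gamma>"
| CoL: "\<Gamma> + {#Bang A, Bang A#} \<turnstile> \<gamma> \<Longrightarrow> \<Gamma> + {#Bang A#} \<turnstile> \<gamma>"

text \<open>Only used on nonempty lists.\<close>

fun big_tensor :: "'a form list \<Rightarrow> 'a form" where
  "big_tensor [] = One"
| "big_tensor [A] = A"
| "big_tensor (A # B # As) = Tensor A (big_tensor (B # As))"

fun pos_tensor :: "'a form \<Rightarrow> bool" where
  "pos_tensor (Atom a) = True"
| "pos_tensor (Tensor A B) = (pos_tensor A \<and> pos_tensor B)"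
| "pos_tensor _ = False"

definition pos_tensor_or_empty :: "'a form option \<Rightarrow> bool" where
  "pos_tensor_or_empty Z \<longleftrightarrow> (\<forall>A. Z = Some A \<longrightarrow> pos_tensor A)"

definition honoured :: "'a form multiset \<Rightarrow> 'a form option \<Rightarrow> bool" where
  "honoured \<Gamma> Z \<longleftrightarrow> \<Gamma> \<turnstile> Z \<and> pos_tensor_or_empty Z"


section \<open>The Horn fragment\<close>

datatype 'a literal = Positive 'a | Negative 'a

fun literal_form :: "'a literal \<Rightarrow> 'a form" where
  "literal_form (Positive a) = Atom a"
| "literal_form (Negative a) = Neg (Atom a)"

text \<open>
  The index sets of the tensor products are given by an enumeration: \<open>X\<close> and \<open>Y\<close> by lists without
  repetitions, the family of clauses of a Horn formula by a list. The abstract syntax records how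
  a formula is divided into clauses, on which the translation depends: \<open>a \<otimes> b\<close> is both a clause,
  with an automaton of rank 1, and the tensor product of two clauses, with an automaton of rank 2.
\<close>

datatype 'a clause =
    TensorClause "'a literal list"
  | ImpClause "'a list" "'a literal list"

datatype 'a horn =
    Horn "'a clause list"
  | Clause "'a clause"

definition literal_product :: "'a literal list \<Rightarrow> bool" where
  "literal_product X \<longleftrightarrow> X \<noteq> [] \<and> distinct X \<and>
     \<not> (\<exists>a. Positive a \<in> set X \<and> Negative a \<in> set X)"

fun wf_clause :: "'a clause \<Rightarrow> bool" where
  "wf_clause (TensorClause X) \<longleftrightarrow> literal_product X"
| "wf_clause (ImpClause Y X) \<longleftrightarrow> literal_product X \<and> Y \<noteq> [] \<and> distinct Y \<and>
     (\<forall>b \<in> set Y. Positive b \<notin> set X)"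

fun wf_horn :: "'a horn \<Rightarrow> bool" where
  "wf_horn (Horn \<alpha>s) \<longleftrightarrow> length \<alpha>s \<ge> 2 \<and> (\<forall>\<alpha> \<in> set \<alpha>s. wf_clause \<alpha>)"
| "wf_horn (Clause \<alpha>) \<longleftrightarrow> wf_clause \<alpha>"

fun clause_form :: "'a clause \<Rightarrow> 'a form" where
  "clause_form (TensorClause X) = big_tensor (map literal_form X)"
| "clause_form (ImpClause Y X) =
     Limp (big_tensor (map Atom Y)) (big_tensor (map literal_form X))"

fun horn_form :: "'a horn \<Rightarrow> 'a form" where
  "horn_form (Horn \<alpha>s) = big_tensor (map clause_form \<alpha>s)"
| "horn_form (Clause \<alpha>) = clause_form \<alpha>"


section \<open>Translation into contract automata\<close>

text \<open>The symbol \<open>\<ast>\<close> is \<open>None\<close>, a literal \<open>l\<close> in a state is \<open>Some l\<close>.\<close>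

definition tensor_states :: "'a literal set \<Rightarrow> 'a literal option set set" where
  "tensor_states X = {insert None (Some ` q) | q. q \<subseteq> X}"

definition tensor_ca :: "'a literal set \<Rightarrow> ('a literal option set, 'a) ca" where
  "tensor_ca X = \<lparr>
     ca_rank = 1,
     ca_states = (\<lambda>q. [q]) ` tensor_states X,
     ca_init = [insert None (Some ` X)],
     ca_requests = {Req a | a. Negative a \<in> X},
     ca_offers = {Off a | a. Positive a \<in> X},
     ca_trans =
       {([insert (Some (Negative a)) Z], [Req a], [Z]) | a Z.
          insert (Some (Negative a)) Z \<in> tensor_states X \<and> Negative a \<in> X \<and>
          Some (Negative a) \<notin> Z}
       \<union> {([insert (Some (Positive a)) Z], [Off a], [Z]) | a Z.
          insert (Some (Positive a)) Z \<in> tensor_states X \<and> Positive a \<in> X \<and>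
          Some (Positive a) \<notin> Z},
     ca_final = {[{None}]} \<rparr>"

text \<open>
  Concatenation presupposes disjoint state sets, which is ensured by the tags \<open>Inl\<close> and \<open>Inr\<close>.
  The two automata of an implication always share the state \<open>{\<ast>}\<close>, and further states
  if \<open>X\<close> contains the negation of an atom of \<open>Y\<close>. Without tags the automaton of
  \<open>b \<multimap> b\<^sup>\<bottom>\<close> would have the transition \<open>({b\<^sup>\<bottom>, \<ast>}, b, {\<ast>})\<close>
  from its initial to its final state, and the automaton of \<open>b, b \<multimap> b\<^sup>\<bottom>\<close> would admit agreement
  on the empty product, although \<open>b, b \<multimap> b\<^sup>\<bottom> \<turnstile>\<close> is not provable.
\<close>

type_synonym 'a principal_state = "'a literal option set + 'a literal option set"

fun clause_ca :: "'a clause \<Rightarrow> ('a principal_state, 'a) ca" where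
  "clause_ca (TensorClause X) = ca_rename Inr (tensor_ca (set X))"
| "clause_ca (ImpClause Y X) =
     ca_concat (ca_rename Inl (tensor_ca (Negative ` set Y))) (ca_rename Inr (tensor_ca (set X)))"

fun horn_ca :: "'a horn \<Rightarrow> ('a principal_state, 'a) ca" where
  "horn_ca (Horn \<alpha>s) = ca_aproduct (map clause_ca \<alpha>s)"
| "horn_ca (Clause \<alpha>) = clause_ca \<alpha>"

text \<open>
  The empty multiset is translated to the empty automaton, which has rank 0, contributes no
  principal to an a-product, and has the empty language as it has no states. The translation of a
  multiset is defined on its enumerations, which fix the order of the principals in the vectors.
\<close>

definition empty_ca :: "('s, 'a) ca" where
  "empty_ca = \<lparr> ca_rank = 0, ca_states = {}, ca_init = [], ca_requests = {}, ca_offers = {},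
     ca_trans = {}, ca_final = {} \<rparr>"

fun horns_ca :: "'a horn list \<Rightarrow> ('a principal_state, 'a) ca" where
  "horns_ca [] = empty_ca"
| "horns_ca (p # \<Gamma>) = ca_aproduct [horn_ca p, horns_ca \<Gamma>]"

fun atom_occs :: "'a form \<Rightarrow> 'a multiset" where
  "atom_occs (Atom a) = {#a#}"
| "atom_occs (Tensor A B) = atom_occs A + atom_occs B"
| "atom_occs _ = {#}"

definition literals_of :: "'a form option \<Rightarrow> 'a multiset" where
  "literals_of Z = (case Z of None \<Rightarrow> {#} | Some A \<Rightarrow> atom_occs A)"

text \<open>
  As the logic is linear, the correspondence between offers and literals of \<open>Z\<close> is one-to-one:
  every atom is offered as many times as it occurs in \<open>Z\<close>.
\<close>

definition admits_agreement :: "('s, 'a) ca \<Rightarrow> 'a form option \<Rightarrow> bool" where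
  "admits_agreement A Z \<longleftrightarrow> (\<exists>w \<in> ca_language A.
     (\<forall>v \<in> set w. match_label v \<or> (\<exists>\<alpha>. offer_on \<alpha> v)) \<and>
     (\<forall>a. length (filter (offer_on (Off a)) w) = count (literals_of Z) a))"

end

theory Submission
  imports Defs "HOL-Library.Set_Algebras"
begin

text \<open>
  Both sides are equivalent to a reachability problem. A configuration is a multiset of literals
  and pending implications; in one step a positive atom is consumed by its negation or by an
  implication that still requires it. The claim is that the clauses of \<open>\<Gamma>\<close> reduce to exactly the
  atoms of \<open>Z\<close>.

  Instead of eliminating cuts, provability is interpreted in an intuitionistic phase space over
  configurations whose facts are the sets closed under expansion. There \<open>\<Gamma> \<turnstile> Z\<close> gives reachability
  by soundness, as every Horn formula contains its own configuration in its denotation.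
  Conversely every step is derivable.

  A principal in a given state stands for the resources it has still to use. Matches then simulate
  reduction steps. Offers can be postponed to the end of a run, where no request is left and
  nothing blocks them in the product.
\<close>

text \<open>Logic and automata disagree on granularity. \<open>LimpL\<close> uses a whole premise at
  once, whereas the automaton of an implication requests its atoms one by one, interleaved with the
  moves of other principals. \<open>Pending ys xs\<close> therefore records a partly served premise;
  logically it is the implication with the shorter premise, which follows from the longer one and
  the atom by currying.

  A reduction step may pick its two resources anywhere, whereas a match needs two different
  principals. Both agree because no clause can react with itself.

  Cut formulae are arbitrary, so every connective needs a denotation, not only those of Horn
  formulae.

  The delicate case throughout is the empty configuration: it reduces trivially to the atoms of the
  empty product, but \<open>{#} \<turnstile> None\<close> is not derivable. It has to be kept out of
  the phase model, out of the derivation built from a reduction, and out of the comparison for the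
  empty multiset of formulae.\<close>

section \<open>Configurations and their reduction\<close>

datatype 'a resource = Lit "'a literal" | Pending "'a list" "'a literal list"

abbreviation lits :: "'a literal list \<Rightarrow> 'a resource multiset" where
  "lits xs \<equiv> image_mset Lit (mset xs)"

abbreviation atoms :: "'a multiset \<Rightarrow> 'a resource multiset" where
  "atoms M \<equiv> image_mset (\<lambda>a. Lit (Positive a)) M"

text \<open>The last premise atom releases the conclusion at once, as concatenation redirects a
  transition into a final state; a reduction thus never creates a \<open>Pending\<close> with
  nothing left to request. The guard \<open>xs \<noteq> []\<close> makes a negative literal the only
  resource that can vanish without a trace.\<close>

inductive consume :: "'a \<Rightarrow> 'a resource \<Rightarrow> 'a resource multiset \<Rightarrow> bool" where
  consume_Negative: "consume a (Lit (Negative a)) {#}"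
| consume_Pending: "a \<in> set ys \<Longrightarrow> remove1 a ys \<noteq> [] \<Longrightarrow>
    consume a (Pending ys xs) {#Pending (remove1 a ys) xs#}"
| consume_last: "xs \<noteq> [] \<Longrightarrow> consume a (Pending [a] xs) (lits xs)"

inductive red :: "'a resource multiset \<Rightarrow> 'a resource multiset \<Rightarrow> bool" where
  "consume a r N \<Longrightarrow> red (K + {#Lit (Positive a), r#}) (K + N)"

lemma red_add_right: "red M N \<Longrightarrow> red (M + L) (N + L)"
proof (induction rule: red.induct)
  case (1 a r N K)
  then have "red ((K + L) + {#Lit (Positive a), r#}) ((K + L) + N)"
    by (rule red.intros)
  then show ?case by (simp add: ac_simps)
qed

lemma reds_add_right: "red\<^sup>*\<^sup>* M N \<Longrightarrow> red\<^sup>*\<^sup>* (M + L) (N + L)"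
proof (induction rule: rtranclp_induct)
  case (step N N')
  from step.IH red_add_right[OF step.hyps(2)] show ?case by (rule rtranclp.rtrancl_into_rtrancl)
qed simp

lemma reds_add: "red\<^sup>*\<^sup>* M N \<Longrightarrow> red\<^sup>*\<^sup>* M' N' \<Longrightarrow> red\<^sup>*\<^sup>* (M + M') (N + N')"
  by (metis add.commute reds_add_right rtranclp_trans)

lemma not_red_empty: "\<not> red {#} M"
  by (auto elim: red.cases)

lemma reds_empty_iff: "red\<^sup>*\<^sup>* {#} M \<longleftrightarrow> M = {#}"
  by (metis converse_rtranclpE not_red_empty rtranclp.rtrancl_refl)

text \<open>Feeding the premise atom by atom has the effect of one application of the implication.
  This makes the stepwise \<open>Pending\<close> a point of the denotation of
  \<open>Limp\<close>.\<close>

lemma reds_Pending: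
  "ys \<noteq> [] \<Longrightarrow> xs \<noteq> [] \<Longrightarrow> red\<^sup>*\<^sup>* (atoms (mset ys) + {#Pending ys xs#}) (lits xs)"
proof (induction ys)
  case (Cons a ys)
  show ?case
  proof (cases "ys = []")
    case True
    have "red ({#} + {#Lit (Positive a), Pending [a] xs#}) ({#} + lits xs)"
      by (intro red.intros consume_last Cons.prems)
    with True show ?thesis by (auto simp: add_mset_commute)
  next
    case False
    have "red (atoms (mset ys) + {#Lit (Positive a), Pending (a # ys) xs#})
        (atoms (mset ys) + {#Pending (remove1 a (a # ys)) xs#})"
      by (intro red.intros consume_Pending) (use False in auto)
    then have "red (atoms (mset (a # ys)) + {#Pending (a # ys) xs#})
        (atoms (mset ys) + {#Pending ys xs#})"
      by (simp add: ac_simps)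
    with Cons.IH[OF False Cons.prems(2)] show ?thesis
      by (rule converse_rtranclp_into_rtranclp[rotated])
  qed
qed simp

section \<open>Phase semantics\<close>

definition down :: "'a resource multiset set \<Rightarrow> 'a resource multiset set" where
  "down S = {M. \<exists>N \<in> S. red\<^sup>*\<^sup>* M N}"

text \<open>
  Excluding the empty multiset accounts for the absence of a nullary \<open>Mix\<close> rule: \<open>{#} \<turnstile> None\<close>
  is not provable.
\<close>
definition falsum :: "'a resource multiset set" where
  "falsum = {M. M \<noteq> {#} \<and> red\<^sup>*\<^sup>* M {#}}"

text \<open>Facts need no biorthogonal closure: unions of sets closed under expansion are closed
  again, so \<open>Plus\<close> is a plain union and \<open>Zero\<close> is empty.
  \<open>Bang A\<close> must be erasable and duplicable, so its points are those that reduce to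
  \<open>{#}\<close>, provided \<open>{#}\<close> itself is a point of \<open>A\<close>; otherwise
  it is empty.\<close>

fun sem :: "'a form \<Rightarrow> 'a resource multiset set" where
  "sem (Atom a) = down {{#Lit (Positive a)#}}"
| "sem (Neg A) = {M. \<forall>N \<in> sem A. M + N \<in> falsum}"
| "sem (Tensor A B) = down (sem A + sem B)"
| "sem (Limp A B) = {M. \<forall>N \<in> sem A. M + N \<in> sem B}"
| "sem One = down {{#}}"
| "sem Bot = falsum"
| "sem Top = UNIV"
| "sem Zero = {}"
| "sem (Plus A B) = sem A \<union> sem B"
| "sem (With A B) = sem A \<inter> sem B"
| "sem (Bang A) = (if {#} \<in> sem A then down {{#}} else {})"

fun sem_option :: "'a form option \<Rightarrow> 'a resource multiset set" where
  "sem_option None = falsum"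
| "sem_option (Some A) = sem A"

abbreviation sem_context :: "'a form multiset \<Rightarrow> 'a resource multiset set" where
  "sem_context \<Gamma> \<equiv> (\<Sum>A \<in># \<Gamma>. sem A)"

text \<open>The empty multiset reduces only to itself, so expanding a nonempty multiset never yields
  it; leaving it out of \<open>falsum\<close> still gives a fact.\<close>

lemma falsum_closed: "N \<in> falsum \<Longrightarrow> red\<^sup>*\<^sup>* M N \<Longrightarrow> M \<in> falsum"
  by (auto simp: falsum_def reds_empty_iff intro: rtranclp_trans)

lemma sem_closed: "N \<in> sem A \<Longrightarrow> red\<^sup>*\<^sup>* M N \<Longrightarrow> M \<in> sem A"
proof (induction A arbitrary: M N)
  case (Neg A)
  then show ?case by (auto intro: falsum_closed reds_add_right)
next
  case (Limp A B)
  then show ?case by (auto intro: Limp.IH reds_add_right)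
qed (auto simp: down_def intro: rtranclp_trans falsum_closed split: if_splits)

lemma sem_option_closed: "N \<in> sem_option \<gamma> \<Longrightarrow> red\<^sup>*\<^sup>* M N \<Longrightarrow> M \<in> sem_option \<gamma>"
  by (cases \<gamma>) (auto intro: falsum_closed sem_closed)

text \<open>A part that reduces to nothing can be erased by reduction, and facts are closed under
  expansion. This validates \<open>Mix\<close>, \<open>OneL\<close> and
  \<open>WeakL\<close>.\<close>

lemma sem_option_add_null:
  assumes "red\<^sup>*\<^sup>* M {#}" "N \<in> sem_option \<gamma>"
  shows "M + N \<in> sem_option \<gamma>"
  using reds_add_right[OF assms(1), of N] sem_option_closed[OF assms(2)] by simp

lemma ball_set_plus: "(\<forall>x \<in> S + T. P x) \<longleftrightarrow> (\<forall>s \<in> S. \<forall>t \<in> T. P (s + t))"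
  by (auto simp: set_plus_def)

text \<open>Serves \<open>BangR\<close>: if the context is empty as a set, nothing has to be shown;
  otherwise \<open>{#}\<close> is one of its points, hence a point of the succedent
  \<open>A\<close>, and all other points reduce to \<open>{#}\<close>, hence lie in
  \<open>Bang A\<close>.\<close>

lemma sem_context_Bang:
  "sem_context (image_mset Bang \<Gamma>) = {} \<or>
   {#} \<in> sem_context (image_mset Bang \<Gamma>) \<and> sem_context (image_mset Bang \<Gamma>) \<subseteq> down {{#}}"
proof (induction \<Gamma>)
  case empty
  then show ?case by (auto simp: down_def)
next
  case (add A \<Gamma>)
  have "down {{#}} + S \<subseteq> down {{#}}" if "S \<subseteq> down {{#}}" for S :: "'a resource multiset set"
    using that by (auto simp: subset_eq ball_set_plus down_def dest: reds_add[where N = "{#}" and N' = "{#}"])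
  moreover have "{#} \<in> down {{#}} + S" if "{#} \<in> S" for S :: "'a resource multiset set"
    using set_plus_intro[of "{#}" "down {{#}}" "{#}" S] that by (auto simp: down_def)
  ultimately show ?case using add by (auto simp: set_plus_def)
qed

text \<open>With this and the next two facts an inclusion of denotations becomes a statement with
  one quantifier per side formula and principal formula, which is the form in which the rules are
  checked.\<close>

lemma ball_sem_context_union:
  "(\<forall>x \<in> sem_context (\<Gamma> + \<Delta>). P x) \<longleftrightarrow> (\<forall>M \<in> sem_context \<Gamma>. \<forall>N \<in> sem_context \<Delta>. P (M + N))"
  by (simp add: ball_set_plus)

lemma ball_sem_context_single: "(\<forall>x \<in> sem_context {#A#}. P x) \<longleftrightarrow> (\<forall>M \<in> sem A. P M)"
  by simp

lemma ball_sem_context_pair: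
  "(\<forall>x \<in> sem_context {#A, B#}. P x) \<longleftrightarrow> (\<forall>M \<in> sem A. \<forall>N \<in> sem B. P (M + N))"
  by (auto simp: ball_set_plus)

lemmas valid_simps = subset_eq ball_sem_context_union ball_sem_context_single ball_sem_context_pair

theorem soundness: "\<Gamma> \<turnstile> \<gamma> \<Longrightarrow> sem_context \<Gamma> \<subseteq> sem_option \<gamma>"
proof (induction rule: ill_mix.induct)
  case (Mix \<Gamma> \<Gamma>' \<gamma>)
  then show ?case
    unfolding valid_simps by (auto simp: falsum_def intro: sem_option_add_null)
next
  case (TensorL \<Gamma> A B \<gamma>)
  have "M + P \<in> sem_option \<gamma>" if "M \<in> sem_context \<Gamma>" and P: "P \<in> sem (Tensor A B)" for M P
  proof -
    \<comment> \<open>A point of a tensor need not be a sum; it only reduces to one. Closure of the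
      succedent under expansion carries membership back to \<open>P\<close>.\<close>
    obtain K L where "K \<in> sem A" "L \<in> sem B" and red: "red\<^sup>*\<^sup>* P (K + L)"
      using P by (auto simp: down_def elim: set_plus_elim)
    then have "M + (K + L) \<in> sem_option \<gamma>"
      using TensorL.IH that(1) unfolding valid_simps by blast
    then show ?thesis by (rule sem_option_closed) (intro reds_add red rtranclp.rtrancl_refl)
  qed
  then show ?case unfolding valid_simps by blast
next
  case (TensorR \<Gamma> A \<Gamma>' B)
  then show ?case
    unfolding valid_simps by (auto simp: down_def)
next
  case (LimpL \<Gamma> A \<Gamma>' B \<gamma>)
  have "M + M' + N \<in> sem_option \<gamma>"
    if "M \<in> sem_context \<Gamma>" "M' \<in> sem_context \<Gamma>'" "N \<in> sem (Limp A B)" for M M' N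
  proof -
    have "N + M \<in> sem B" using LimpL.IH(1) that by auto
    then have "M' + (N + M) \<in> sem_option \<gamma>"
      using LimpL.IH(2) that(2) unfolding valid_simps by blast
    then show ?thesis by (simp only: ac_simps)
  qed
  then show ?case unfolding valid_simps by blast
next
  case (Cut \<Gamma> A \<Gamma>' \<gamma>)
  have "M + N \<in> sem_option \<gamma>" if "M \<in> sem_context \<Gamma>" "N \<in> sem_context \<Gamma>'" for M N
  proof -
    have "M \<in> sem A" using Cut.IH(1) that by auto
    then have "N + M \<in> sem_option \<gamma>" using Cut.IH(2) that unfolding valid_simps by blast
    then show ?thesis by (simp only: add.commute)
  qed
  then show ?case unfolding valid_simps by blast
next
  case (NegL \<Gamma> A)
  have "M + N \<in> falsum" if "M \<in> sem_context \<Gamma>" "N \<in> sem (Neg A)" for M N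
  proof -
    have "N + M \<in> falsum" using NegL.IH that by auto
    then show ?thesis by (simp only: add.commute)
  qed
  then show ?case unfolding valid_simps by auto
next
  case (OneL \<Gamma> \<gamma>)
  have "M + N \<in> sem_option \<gamma>" if "M \<in> sem_context \<Gamma>" and N: "N \<in> sem One" for M N
  proof -
    have "red\<^sup>*\<^sup>* N {#}" using N by (auto simp: down_def split: if_splits)
    moreover have "M \<in> sem_option \<gamma>" using OneL.IH that by blast
    ultimately have "N + M \<in> sem_option \<gamma>" by (rule sem_option_add_null)
    then show ?thesis by (simp only: add.commute)
  qed
  then show ?case unfolding valid_simps by blast
next
  case (WeakL \<Gamma> \<gamma> A)
  have "M + N \<in> sem_option \<gamma>" if "M \<in> sem_context \<Gamma>" and N: "N \<in> sem (Bang A)" for M N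
  proof -
    have "red\<^sup>*\<^sup>* N {#}" using N by (auto simp: down_def split: if_splits)
    moreover have "M \<in> sem_option \<gamma>" using WeakL.IH that by blast
    ultimately have "N + M \<in> sem_option \<gamma>" by (rule sem_option_add_null)
    then show ?thesis by (simp only: add.commute)
  qed
  then show ?case unfolding valid_simps by blast
next
  case (CoL \<Gamma> A \<gamma>)
  \<comment> \<open>Contraction: one copy of \<open>Bang A\<close> receives \<open>N\<close>, the
    other \<open>{#}\<close>, which is a point of \<open>Bang A\<close> as soon as there is
    any.\<close>
  have "M + (N + {#}) \<in> sem_option \<gamma>"
    if "M \<in> sem_context \<Gamma>" and N: "N \<in> sem (Bang A)" for M N
  proof -
    have "{#} \<in> sem (Bang A)" using N by (auto simp: down_def split: if_splits)
    then show ?thesis using CoL.IH that unfolding valid_simps by blast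
  qed
  then show ?case unfolding valid_simps by simp
next
  case (BangL \<Gamma> A \<gamma>)
  have "sem (Bang A) \<subseteq> sem A" by (auto simp: down_def intro: sem_closed)
  then show ?case using BangL.IH unfolding valid_simps by blast
next
  case (BangR \<Gamma> A)
  then show ?case using sem_context_Bang[of \<Gamma>] by auto
next
  case BotL
  then show ?case by simp
next
  case OneR
  then show ?case by (simp add: down_def)
next
  case (PlusL \<Gamma> A \<gamma> B)
  then show ?case unfolding valid_simps by auto
qed (unfold valid_simps, simp_all)

lemma sem_big_tensor:
  "list_all2 (\<lambda>M A. M \<in> sem A) Ms As \<Longrightarrow> sum_list Ms \<in> sem (big_tensor As)"
proof (induction As arbitrary: Ms rule: big_tensor.induct)
  case (3 A B As)
  then obtain M Ns where Ms: "Ms = M # Ns" "M \<in> sem A" "list_all2 (\<lambda>M A. M \<in> sem A) Ns (B # As)"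
    by (auto simp: list_all2_Cons2)
  with 3 have "sum_list Ns \<in> sem (big_tensor (B # As))" by blast
  with Ms have "sum_list Ms \<in> sem A + sem (big_tensor (B # As))" by auto
  then show ?case by (auto simp: down_def)
qed (auto simp: down_def list_all2_Cons2)

text \<open>A positive tensor is generated by the single configuration of its atoms. This is the
  step that turns membership in the denotation of the succedent into reachability.\<close>

lemma sem_pos_tensor:
  "pos_tensor A \<Longrightarrow> M \<in> sem A \<Longrightarrow> red\<^sup>*\<^sup>* M (atoms (atom_occs A))"
proof (induction A arbitrary: M)
  case (Tensor A B)
  then obtain P Q where *: "P \<in> sem A" "Q \<in> sem B" "red\<^sup>*\<^sup>* M (P + Q)"
    by (auto simp: down_def set_plus_def)
  with Tensor have "red\<^sup>*\<^sup>* (P + Q) (atoms (atom_occs (Tensor A B)))" 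
    by (auto intro: reds_add)
  with * show ?case by (auto intro: rtranclp_trans)
qed (auto simp: down_def)

section \<open>Resources of Horn formulae\<close>

fun clause_resources :: "'a clause \<Rightarrow> 'a resource multiset" where
  "clause_resources (TensorClause X) = lits X"
| "clause_resources (ImpClause Y X) = {#Pending Y X#}"

fun clauses :: "'a horn \<Rightarrow> 'a clause list" where
  "clauses (Horn \<alpha>s) = \<alpha>s"
| "clauses (Clause \<alpha>) = [\<alpha>]"

abbreviation clauses_resources :: "'a clause list \<Rightarrow> 'a resource multiset" where
  "clauses_resources \<alpha>s \<equiv> (\<Sum>\<alpha> \<leftarrow> \<alpha>s. clause_resources \<alpha>)"

text \<open>A negated atom annihilates with whatever reduces to the atom. The nonemptiness demanded
  by \<open>falsum\<close> comes from the literal itself.\<close>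

lemma sem_literal: "{#Lit l#} \<in> sem (literal_form l)"
proof (cases l)
  case (Negative a)
  have "{#Lit l#} + M \<in> falsum" if "red\<^sup>*\<^sup>* M {#Lit (Positive a)#}" for M
  proof -
    have "red ({#} + {#Lit (Positive a), Lit (Negative a)#}) ({#} + {#})"
      by (intro red.intros consume.intros)
    then show ?thesis
      using reds_add_right[OF that, of "{#Lit l#}"] Negative
      by (auto simp: falsum_def add_mset_commute intro: rtranclp.rtrancl_into_rtrancl)
  qed
  with Negative show ?thesis by (auto simp: down_def)
qed (auto simp: down_def)

lemma sem_lits: "lits X \<in> sem (big_tensor (map literal_form X))"
proof -
  have "sum_list (map (\<lambda>l. {#Lit l#}) X) \<in> sem (big_tensor (map literal_form X))"
    by (rule sem_big_tensor) (auto simp: list_all2_conv_all_nth sem_literal)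
  moreover have "sum_list (map (\<lambda>l. {#Lit l#}) X) = lits X" by (induction X) auto
  ultimately show ?thesis by simp
qed

lemma pos_tensor_big_tensor: "ys \<noteq> [] \<Longrightarrow>
    pos_tensor (big_tensor (map Atom ys)) \<and> atom_occs (big_tensor (map Atom ys)) = mset ys"
proof (induction ys)
  case (Cons a ys)
  then show ?case by (cases ys) auto
qed simp

lemma sem_clause: "wf_clause \<alpha> \<Longrightarrow> clause_resources \<alpha> \<in> sem (clause_form \<alpha>)"
proof (cases \<alpha>)
  case (ImpClause Y X)
  assume "wf_clause \<alpha>"
  with ImpClause have ne: "Y \<noteq> []" "X \<noteq> []" by (auto simp: literal_product_def)
  have "{#Pending Y X#} + M \<in> sem (big_tensor (map literal_form X))"
    if "M \<in> sem (big_tensor (map Atom Y))" for M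
  proof -
    \<comment> \<open>An arbitrary point of the premise is first brought to its atoms, which can
      then serve the pending implication.\<close>
    have "red\<^sup>*\<^sup>* M (atoms (mset Y))"
      using sem_pos_tensor[OF _ that] pos_tensor_big_tensor[OF ne(1)] by simp
    then have "red\<^sup>*\<^sup>* (M + {#Pending Y X#}) (lits X)"
      using reds_add_right[of M _ "{#Pending Y X#}"] reds_Pending[OF ne]
      by (blast intro: rtranclp_trans)
    then show ?thesis using sem_lits[of X] by (auto intro: sem_closed simp: add.commute)
  qed
  with ImpClause show ?thesis by simp
qed (auto simp: sem_lits)

lemma sem_horn: "wf_horn p \<Longrightarrow> clauses_resources (clauses p) \<in> sem (horn_form p)"
proof (cases p)
  case (Horn \<alpha>s)
  assume "wf_horn p"
  with Horn have "list_all2 (\<lambda>M A. M \<in> sem A) (map clause_resources \<alpha>s) (map clause_form \<alpha>s)"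
    by (auto simp: list_all2_conv_all_nth sem_clause)
  with Horn show ?thesis by (auto dest: sem_big_tensor)
qed (auto simp: sem_clause)

lemma sem_horns: "\<forall>p \<in> set \<Gamma>s. wf_horn p \<Longrightarrow>
    clauses_resources (concat (map clauses \<Gamma>s)) \<in> sem_context (mset (map horn_form \<Gamma>s))"
  by (induction \<Gamma>s) (auto intro: set_plus_intro sem_horn)

lemma reds_if_provable:
  assumes "mset (map horn_form \<Gamma>s) \<turnstile> Z" "\<forall>p \<in> set \<Gamma>s. wf_horn p" "pos_tensor_or_empty Z"
  shows "red\<^sup>*\<^sup>* (clauses_resources (concat (map clauses \<Gamma>s))) (atoms (literals_of Z))"
proof -
  have "clauses_resources (concat (map clauses \<Gamma>s)) \<in> sem_option Z"
    using soundness[OF assms(1)] sem_horns[OF assms(2)] by blast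
  then show ?thesis
    using assms(3)
    by (cases Z) (auto simp: literals_of_def falsum_def pos_tensor_or_empty_def sem_pos_tensor)
qed

lemma atom_occs_nonempty: "pos_tensor A \<Longrightarrow> atom_occs A \<noteq> {#}"
  by (induction A) auto

text \<open>The empty context denotes \<open>{{#}}\<close>. Its point is outside
  \<open>falsum\<close>, and it cannot reduce to a positive tensor, which has at least one
  atom.\<close>

lemma nonempty_if_provable: "\<Gamma> \<turnstile> Z \<Longrightarrow> pos_tensor_or_empty Z \<Longrightarrow> \<Gamma> \<noteq> {#}"
proof
  assume "\<Gamma> \<turnstile> Z" and Z: "pos_tensor_or_empty Z" and "\<Gamma> = {#}"
  then have *: "{#} \<in> sem_option Z" using soundness[of \<Gamma> Z] by simp
  with Z obtain A where "Z = Some A" "pos_tensor A"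
    by (cases Z) (auto simp: falsum_def pos_tensor_or_empty_def)
  with * show False
    using sem_pos_tensor[of A "{#}"] by (simp add: reds_empty_iff atom_occs_nonempty)
qed

section \<open>Provability from reduction\<close>

fun resource_form :: "'a resource \<Rightarrow> 'a form" where
  "resource_form (Lit l) = literal_form l"
| "resource_form (Pending ys xs) = clause_form (ImpClause ys xs)"

lemma big_tensor_left:
  "As \<noteq> [] \<Longrightarrow> \<Gamma> + mset As \<turnstile> \<gamma> \<Longrightarrow> \<Gamma> + {#big_tensor As#} \<turnstile> \<gamma>"
proof (induction As arbitrary: \<Gamma> rule: big_tensor.induct)
  case (3 A B As)
  have "(\<Gamma> + {#A#}) + {#big_tensor (B # As)#} \<turnstile> \<gamma>"
    by (rule "3.IH") (use "3.prems" in \<open>simp_all add: add_mset_commute\<close>)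
  then show ?case using TensorL[of \<Gamma> A "big_tensor (B # As)" \<gamma>] by (simp add: add_mset_commute)
qed auto

lemma pos_tensor_right: "pos_tensor A \<Longrightarrow> image_mset Atom (atom_occs A) \<turnstile> Some A"
  by (induction A) (auto intro: Ax TensorR)

text \<open>The supplied atoms \<open>zs\<close> may come in another order than the premise
  \<open>ys\<close>, since the consumed atom need not be the first of \<open>ys\<close>.\<close>

lemma pending_apply:
  assumes "mset zs = mset ys" "ys \<noteq> []" "\<Gamma> + {#B#} \<turnstile> \<gamma>"
  shows "\<Gamma> + image_mset Atom (mset zs) + {#Limp (big_tensor (map Atom ys)) B#} \<turnstile> \<gamma>"
proof -
  have "image_mset Atom (mset zs) \<turnstile> Some (big_tensor (map Atom ys))"
    using pos_tensor_right[of "big_tensor (map Atom ys)"] pos_tensor_big_tensor[OF assms(2)] assms(1)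
    by simp
  from LimpL[OF this assms(3)] show ?thesis by (simp add: ac_simps)
qed

text \<open>One reduction step read backwards as a derivation: annihilation is \<open>NegL\<close>
  with \<open>Mix\<close>, serving a premise atom is currying with \<open>Cut\<close>, and serving
  the last one is \<open>LimpL\<close>.\<close>

lemma provable_consume:
  assumes "consume a r N" "K + image_mset resource_form N \<turnstile> Z"
    "N \<noteq> {#} \<or> K \<noteq> {#}"
  shows "K + {#Atom a, resource_form r#} \<turnstile> Z"
  using assms
proof cases
  case consume_Negative
  have "{#Atom a#} + {#Neg (Atom a)#} \<turnstile> None" by (intro NegL Ax)
  from Mix[OF this] assms(2) consume_Negative show ?thesis by (auto simp: add_mset_commute)
next
  case (consume_Pending ys xs)
  let ?B = "big_tensor (map literal_form xs)"
  let ?A = "\<lambda>ys. Limp (big_tensor (map Atom ys)) ?B"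
  define zs where "zs = remove1 a ys"
  \<comment> \<open>Currying: the atom \<open>a\<close> is kept in the context, the remaining
    premise is abstracted by \<open>LimpR\<close>, and \<open>Cut\<close> then exchanges the shorter
    implication for \<open>a\<close> and the longer one.\<close>
  have "{#} + image_mset Atom (mset (a # zs)) + {#?A ys#} \<turnstile> Some ?B"
    by (rule pending_apply) (use consume_Pending in \<open>auto simp: zs_def intro: Ax\<close>)
  then have "{#Atom a, ?A ys#} + mset (map Atom zs) \<turnstile> Some ?B"
    by (simp add: add_mset_commute)
  then have "{#Atom a, ?A ys#} + {#big_tensor (map Atom zs)#} \<turnstile> Some ?B"
    using consume_Pending by (intro big_tensor_left) (auto simp: zs_def)
  then have "{#Atom a, ?A ys#} \<turnstile> Some (?A zs)" by (rule LimpR)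
  then have "{#Atom a, ?A ys#} + K \<turnstile> Z"
    by (rule Cut) (use assms(2) consume_Pending in \<open>simp add: zs_def\<close>)
  with consume_Pending show ?thesis by (simp add: ac_simps)
next
  case (consume_last xs)
  have "K + {#big_tensor (map literal_form xs)#} \<turnstile> Z"
    using assms(2) consume_last by (intro big_tensor_left) (auto simp: image_mset.compositionality comp_def)
  from pending_apply[OF _ _ this, of "[a]" "[a]"] consume_last show ?thesis
    by (simp add: add_mset_commute)
qed

lemma provable_if_reds:
  assumes "red\<^sup>*\<^sup>* M (atoms (literals_of Z))" "M \<noteq> {#}" "pos_tensor_or_empty Z"
  shows "image_mset resource_form M \<turnstile> Z"
  using assms(1,2)
proof (induction rule: converse_rtranclp_induct)
  case base
  with assms(3) obtain A where "Z = Some A" "pos_tensor A"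
    by (cases Z) (auto simp: literals_of_def pos_tensor_or_empty_def)
  then show ?case using pos_tensor_right[of A]
    by (simp add: literals_of_def image_mset.compositionality comp_def)
next
  case (step M M')
  from step(1) obtain K a r N where M: "M = K + {#Lit (Positive a), r#}" "M' = K + N" "consume a r N"
    by (auto elim: red.cases)
  show ?case
  proof (cases "M' = {#}")
    \<comment> \<open>The induction hypothesis says nothing about an exhausted configuration, as
      \<open>{#} \<turnstile> None\<close> has no derivation. Only an atom meeting its negation
      leaves nothing behind, so here the derivation starts with an axiom and
      \<open>NegL\<close>.\<close>
    case True
    with step(2) have "literals_of Z = {#}" by (simp add: reds_empty_iff)
    then have "Z = None"
      using assms(3) atom_occs_nonempty by (cases Z) (auto simp: literals_of_def pos_tensor_or_empty_def)
    moreover have "r = Lit (Negative a)" using M True by (auto elim: consume.cases)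
    moreover have "{#Atom a#} + {#Neg (Atom a)#} \<turnstile> None" by (intro NegL Ax)
    ultimately show ?thesis using M True by (simp add: add_mset_commute)
  next
    case False
    with step.IH M(2) have "image_mset resource_form K + image_mset resource_form N \<turnstile> Z" by simp
    moreover have "N \<noteq> {#} \<or> image_mset resource_form K \<noteq> {#}" using False M(2) by auto
    ultimately show ?thesis using provable_consume[OF M(3)] M(1) by simp
  qed
qed

section \<open>Decomposing Horn formulae on the left of a sequent\<close>

lemma clause_left:
  assumes "wf_clause \<alpha>" "\<Gamma> + image_mset resource_form (clause_resources \<alpha>) \<turnstile> \<gamma>"
  shows "\<Gamma> + {#clause_form \<alpha>#} \<turnstile> \<gamma>"
  using assms big_tensor_left[of "map literal_form _" \<Gamma> \<gamma>]
  by (cases \<alpha>) (auto simp: literal_product_def image_mset.compositionality comp_def)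

lemma clauses_left:
  assumes "\<forall>\<alpha> \<in> set \<alpha>s. wf_clause \<alpha>"
    and "\<Gamma> + image_mset resource_form (clauses_resources \<alpha>s) \<turnstile> \<gamma>"
  shows "\<Gamma> + mset (map clause_form \<alpha>s) \<turnstile> \<gamma>"
  using assms
proof (induction \<alpha>s arbitrary: \<Gamma>)
  case (Cons \<alpha> \<alpha>s)
  have "(\<Gamma> + image_mset resource_form (clause_resources \<alpha>)) + mset (map clause_form \<alpha>s) \<turnstile> \<gamma>"
    using Cons.prems by (intro Cons.IH) (auto simp: ac_simps)
  then have "(\<Gamma> + mset (map clause_form \<alpha>s)) + {#clause_form \<alpha>#} \<turnstile> \<gamma>"
    using Cons.prems by (intro clause_left) (auto simp: ac_simps)
  then show ?case by simp
qed simp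

lemma horn_left:
  assumes "wf_horn p" "\<Gamma> + image_mset resource_form (clauses_resources (clauses p)) \<turnstile> \<gamma>"
  shows "\<Gamma> + {#horn_form p#} \<turnstile> \<gamma>"
proof (cases p)
  case (Horn \<alpha>s)
  have "\<Gamma> + mset (map clause_form \<alpha>s) \<turnstile> \<gamma>"
    using assms Horn by (intro clauses_left) auto
  moreover have "map clause_form \<alpha>s \<noteq> []" using assms(1) Horn by auto
  ultimately show ?thesis using Horn big_tensor_left[of "map clause_form \<alpha>s" \<Gamma> \<gamma>] by simp
next
  case (Clause \<alpha>)
  with assms clause_left[of \<alpha> \<Gamma> \<gamma>] show ?thesis by simp
qed

lemma horns_left:
  assumes "\<forall>p \<in> set \<Gamma>s. wf_horn p"
    and "\<Gamma> + image_mset resource_form (clauses_resources (concat (map clauses \<Gamma>s))) \<turnstile> \<gamma>"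
  shows "\<Gamma> + mset (map horn_form \<Gamma>s) \<turnstile> \<gamma>"
  using assms
proof (induction \<Gamma>s arbitrary: \<Gamma>)
  case (Cons p \<Gamma>s)
  have "(\<Gamma> + image_mset resource_form (clauses_resources (clauses p))) + mset (map horn_form \<Gamma>s) \<turnstile> \<gamma>"
    using Cons.prems by (intro Cons.IH) (auto simp: ac_simps)
  then have "(\<Gamma> + mset (map horn_form \<Gamma>s)) + {#horn_form p#} \<turnstile> \<gamma>"
    using Cons.prems by (intro horn_left) (auto simp: ac_simps)
  then show ?case by simp
qed simp

lemma clause_resources_nonempty: "wf_clause \<alpha> \<Longrightarrow> clause_resources \<alpha> \<noteq> {#}"
  by (cases \<alpha>) (auto simp: literal_product_def)

lemma clauses_resources_nonempty: 
  assumes "\<forall>p \<in> set \<Gamma>s. wf_horn p" "\<Gamma>s \<noteq> []"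
  shows "clauses_resources (concat (map clauses \<Gamma>s)) \<noteq> {#}"
proof -
  obtain p \<Delta> where p: "\<Gamma>s = p # \<Delta>" using assms(2) by (cases \<Gamma>s) auto
  with assms have "clauses p \<noteq> []" "\<forall>\<alpha> \<in> set (clauses p). wf_clause \<alpha>" by (cases p; auto)+
  then show ?thesis using p by (cases "clauses p") (auto simp: clause_resources_nonempty)
qed

text \<open>\<open>\<Gamma>s \<noteq> []\<close> rules out the trivial reduction of
  \<open>{#}\<close> to the atoms of the empty product, which corresponds to no derivation.\<close>

theorem provable_iff_reds:
  assumes wf: "\<forall>p \<in> set \<Gamma>s. wf_horn p" and Z: "pos_tensor_or_empty Z"
  shows "mset (map horn_form \<Gamma>s) \<turnstile> Z \<longleftrightarrow>
    \<Gamma>s \<noteq> [] \<and> red\<^sup>*\<^sup>* (clauses_resources (concat (map clauses \<Gamma>s))) (atoms (literals_of Z))"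
proof (intro iffI conjI; (elim conjE)?)
  assume *: "mset (map horn_form \<Gamma>s) \<turnstile> Z"
  then show "red\<^sup>*\<^sup>* (clauses_resources (concat (map clauses \<Gamma>s))) (atoms (literals_of Z))"
    using wf Z by (rule reds_if_provable)
  show "\<Gamma>s \<noteq> []"
    using nonempty_if_provable[OF * Z] by simp
next
  assume "\<Gamma>s \<noteq> []" and
    "red\<^sup>*\<^sup>* (clauses_resources (concat (map clauses \<Gamma>s))) (atoms (literals_of Z))"
  then have "image_mset resource_form (clauses_resources (concat (map clauses \<Gamma>s))) \<turnstile> Z"
    using clauses_resources_nonempty[OF wf] Z by (intro provable_if_reds)
  then show "mset (map horn_form \<Gamma>s) \<turnstile> Z"
    using horns_left[OF wf, of "{#}" Z] by simp
qed

section \<open>Products of principals\<close>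

text \<open>A rank 1 operand that projection can recover from a product. An empty set of final
  states in one operand would empty that of the product, hence the nonemptiness; labels are not idle
  because projection discards idle moves.\<close>

definition principal :: "('s, 'a) ca \<Rightarrow> bool" where
  "principal A \<longleftrightarrow> ca_rank A = 1 \<and> ca_init A \<in> ca_states A \<and>
     ca_final A \<noteq> {} \<and> ca_final A \<subseteq> ca_states A \<and> (\<forall>q \<in> ca_states A. length q = 1) \<and>
     (\<forall>(q, v, q') \<in> ca_trans A. q \<in> ca_states A \<and> q' \<in> ca_states A \<and> (\<exists>\<alpha>. \<alpha> \<noteq> Idle \<and> v = [\<alpha>]))"

lemma principal_trans:
  assumes "principal A" "(q, v, q') \<in> ca_trans A"
  obtains s \<alpha> s' where "q = [s]" "v = [\<alpha>]" "q' = [s']" "\<alpha> \<noteq> Idle" "[s] \<in> ca_states A" "[s'] \<in> ca_states A"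
proof -
  from assms have *: "q \<in> ca_states A" "q' \<in> ca_states A" "\<exists>\<alpha>. \<alpha> \<noteq> Idle \<and> v = [\<alpha>]"
    by (auto simp: principal_def)
  with assms(1) have "length q = 1" "length q' = 1" by (auto simp: principal_def)
  with * that show thesis by (auto simp: length_Suc_conv)
qed

lemma principalD:
  assumes "principal P"
  shows "ca_rank P = 1" "ca_init P \<in> ca_states P" "ca_states P \<noteq> {}" "ca_final P \<noteq> {}"
    "ca_final P \<subseteq> ca_states P"
  using assms by (auto simp: principal_def)

lemma listset_iff: "qs \<in> listset Ss \<longleftrightarrow> list_all2 (\<in>) qs Ss"
  by (induction Ss arbitrary: qs) (auto simp: set_Cons_def list_all2_Cons2)

text \<open>For operands of rank 1 a tuple of component states is a flat list with each entry
  wrapped, and \<open>concat\<close> unwraps it. Product states can thus be indexed by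
  principal.\<close>

lemma listset_singletons:
  assumes "\<And>S q. S \<in> set Ss \<Longrightarrow> q \<in> S \<Longrightarrow> length q = 1"
  shows "listset Ss = map (\<lambda>s. [s]) ` {q. length q = length Ss \<and> (\<forall>i < length Ss. [q ! i] \<in> Ss ! i)}"
proof (intro equalityI subsetI)
  fix qs assume *: "qs \<in> listset Ss"
  then have "length (qs ! i) = 1" if "i < length Ss" for i
    using that assms[of "Ss ! i" "qs ! i"] by (auto simp: listset_iff list_all2_conv_all_nth)
  then have "[hd (qs ! i)] = qs ! i" if "i < length Ss" for i
    using that by (metis One_nat_def length_0_conv length_Suc_conv list.sel(1))
  with * show "qs \<in> map (\<lambda>s. [s]) ` {q. length q = length Ss \<and> (\<forall>i < length Ss. [q ! i] \<in> Ss ! i)}"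
    by (intro image_eqI[where x = "map hd qs"])
      (auto simp: listset_iff list_all2_conv_all_nth intro: nth_equalityI)
qed (auto simp: listset_iff list_all2_conv_all_nth)

lemma single_complementary: "[\<alpha>] \<bowtie> [\<beta>] \<longleftrightarrow> \<alpha> \<noteq> Idle \<and> \<beta> = co \<alpha>"
proof -
  have *: "[x] = replicate m Idle @ [y] @ replicate n Idle \<longleftrightarrow> x = y \<and> m = 0 \<and> n = 0" 
    for x y :: "'a action" and m n
    by (cases m) auto
  show ?thesis
    unfolding complementary_def request_on_def offer_on_def * by (cases \<alpha>) auto
qed

lemma co_co [simp]: "co (co \<alpha>) = \<alpha>"
  by (cases \<alpha>) auto

lemma co_eq_Idle_iff [simp]: "co \<alpha> = Idle \<longleftrightarrow> \<alpha> = Idle"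
  by (cases \<alpha>) auto

lemma principal_single: "principal A \<Longrightarrow> q \<in> ca_states A \<Longrightarrow> length q = 1"
  by (auto simp: principal_def)

lemma principals_listset:
  assumes "\<forall>P \<in> set Ps. principal P"
  shows "listset (map ca_states Ps) =
      map (\<lambda>s. [s]) ` {q. length q = length Ps \<and> (\<forall>i < length Ps. [q ! i] \<in> ca_states (Ps ! i))}"
    and "listset (map ca_final Ps) =
      map (\<lambda>s. [s]) ` {q. length q = length Ps \<and> (\<forall>i < length Ps. [q ! i] \<in> ca_final (Ps ! i))}"
proof -
  have *: "length q = 1" if "P \<in> set Ps" "q \<in> ca_states P" for P q
    using assms that principal_single by blast
  have "length q = 1" if "S \<in> set (map ca_states Ps)" "q \<in> S" for S q
    using * that by auto
  from listset_singletons[of "map ca_states Ps", OF this] show "listset (map ca_states Ps) =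
      map (\<lambda>s. [s]) ` {q. length q = length Ps \<and> (\<forall>i < length Ps. [q ! i] \<in> ca_states (Ps ! i))}"
    by simp
  have "length q = 1" if S: "S \<in> set (map ca_final Ps)" "q \<in> S" for S q
  proof -
    from S obtain P where P: "P \<in> set Ps" "q \<in> ca_final P" by auto
    with assms have "q \<in> ca_states P" by (auto simp: principal_def)
    with * P show ?thesis by blast
  qed
  from listset_singletons[of "map ca_final Ps", OF this] show "listset (map ca_final Ps) =
      map (\<lambda>s. [s]) ` {q. length q = length Ps \<and> (\<forall>i < length Ps. [q ! i] \<in> ca_final (Ps ! i))}"
    by simp
qed

lemma product_states:
  assumes "\<forall>P \<in> set Ps. principal P"
  shows "ca_states (ca_product Ps) = {q. length q = length Ps \<and> (\<forall>i < length Ps. [q ! i] \<in> ca_states (Ps ! i))}"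
  by (simp add: ca_product_def principals_listset[OF assms] image_image)

lemma product_final:
  assumes "\<forall>P \<in> set Ps. principal P"
  shows "ca_final (ca_product Ps) = {q. length q = length Ps \<and> (\<forall>i < length Ps. [q ! i] \<in> ca_final (Ps ! i))}"
  by (simp add: ca_product_def principals_listset[OF assms] image_image)

lemma principal_init: "principal P \<Longrightarrow> [hd (ca_init P)] = ca_init P"
  by (cases "ca_init P") (auto simp: principal_def)

lemma product_init:
  assumes "\<forall>P \<in> set Ps. principal P"
  shows "ca_init (ca_product Ps) = map (hd \<circ> ca_init) Ps"
proof -
  have "map ca_init Ps = map (\<lambda>s. [s]) (map (hd \<circ> ca_init) Ps)"
    using assms by (auto simp: principal_init)
  then have "concat (map ca_init Ps) = map (hd \<circ> ca_init) Ps"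
    by (simp only: concat_map_singleton map_ident)
  then show ?thesis by (simp add: ca_product_def)
qed

lemma product_rank:
  assumes "\<forall>P \<in> set Ps. principal P"
  shows "ca_rank (ca_product Ps) = length Ps"
proof -
  have "map ca_rank Ps = map (\<lambda>_. 1) Ps" using assms by (auto simp: principal_def)
  then have "sum_list (map ca_rank Ps) = length Ps" by (simp only: sum_list_triv) simp
  then show ?thesis by (simp add: ca_product_def)
qed

lemma principals_idles:
  assumes "\<forall>P \<in> set Ps. principal P"
  shows "ca_idles Ps = map (\<lambda>x. [x]) (replicate (length Ps) Idle)"
  using assms by (auto simp: ca_idles_def principal_def intro!: nth_equalityI)

lemma concat_update_singleton:
  "concat ((map (\<lambda>s. [s]) x)[i := [a]]) = x[i := a]"
  "concat ((map (\<lambda>s. [s]) x)[i := [a], j := [b]]) = x[i := a, j := b]"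
proof -
  have *: "(map (\<lambda>s. [s]) x)[i := [a]] = map (\<lambda>s. [s]) (x[i := a])" for x :: "'a list" and i a
    by (simp add: map_update)
  show "concat ((map (\<lambda>s. [s]) x)[i := [a]]) = x[i := a]"
    "concat ((map (\<lambda>s. [s]) x)[i := [a], j := [b]]) = x[i := a, j := b]"
    unfolding * by simp_all
qed

lemma product_trans_iff:
  "(p, t, p') \<in> ca_trans (ca_product As) \<longleftrightarrow>
     (\<exists>qs i j v w q' r'. p = concat qs \<and> t = concat ((ca_idles As)[i := v, j := w]) \<and>
        p' = concat (qs[i := q', j := r']) \<and>
        qs \<in> listset (map ca_states As) \<and> i < j \<and> j < length As \<and>
        (qs ! i, v, q') \<in> ca_trans (As ! i) \<and> (qs ! j, w, r') \<in> ca_trans (As ! j) \<and> v \<bowtie> w) \<or>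
     (\<exists>qs i v q'. p = concat qs \<and> t = concat ((ca_idles As)[i := v]) \<and> p' = concat (qs[i := q']) \<and>
        qs \<in> listset (map ca_states As) \<and> i < length As \<and>
        (qs ! i, v, q') \<in> ca_trans (As ! i) \<and>
        (\<forall>j < length As. j \<noteq> i \<longrightarrow> \<not> (\<exists>w r'. (qs ! j, w, r') \<in> ca_trans (As ! j) \<and> v \<bowtie> w)))"
  unfolding ca_product_def by simp

lemma product_trans_cases:
  assumes Ps: "\<forall>P \<in> set Ps. principal P" and "(q, v, q') \<in> ca_trans (ca_product Ps)"
  obtains (joint) i j \<alpha> s r where "i < j" "j < length Ps" "\<alpha> \<noteq> Idle"
      "([q ! i], [\<alpha>], [s]) \<in> ca_trans (Ps ! i)" "([q ! j], [co \<alpha>], [r]) \<in> ca_trans (Ps ! j)"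
      "v = (replicate (length Ps) Idle)[i := \<alpha>, j := co \<alpha>]" "q' = q[i := s, j := r]"
      "q \<in> ca_states (ca_product Ps)"
    | (solo) i \<alpha> s where "i < length Ps" "\<alpha> \<noteq> Idle" "([q ! i], [\<alpha>], [s]) \<in> ca_trans (Ps ! i)"
      "v = (replicate (length Ps) Idle)[i := \<alpha>]" "q' = q[i := s]"
      "q \<in> ca_states (ca_product Ps)"
proof -
  let ?S = "ca_states (ca_product Ps)"
  note princ = Ps[rule_format, OF nth_mem]
  from assms(2) consider
    (1) qs i j u w s r where "q = concat qs" "v = concat ((ca_idles Ps)[i := u, j := w])"
      "q' = concat (qs[i := s, j := r])" "qs \<in> listset (map ca_states Ps)" "i < j" "j < length Ps"
      "(qs ! i, u, s) \<in> ca_trans (Ps ! i)" "(qs ! j, w, r) \<in> ca_trans (Ps ! j)" "u \<bowtie> w"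
    | (2) qs i u s where "q = concat qs" "v = concat ((ca_idles Ps)[i := u])"
      "q' = concat (qs[i := s])" "qs \<in> listset (map ca_states Ps)" "i < length Ps"
      "(qs ! i, u, s) \<in> ca_trans (Ps ! i)"
    unfolding product_trans_iff by blast
  then show thesis
  proof cases
    case 1
    then obtain x where x: "qs = map (\<lambda>s. [s]) x" "length x = length Ps"
      using principals_listset(1)[OF Ps] by auto
    from 1 have i: "i < length Ps" by simp
    from princ[OF i] 1(7) obtain \<alpha> s0 where 2: "u = [\<alpha>]" "s = [s0]" "\<alpha> \<noteq> Idle"
      by (blast elim: principal_trans)
    from princ[OF 1(6)] 1(8) obtain \<beta> r0 where 3: "w = [\<beta>]" "r = [r0]"
      by (blast elim: principal_trans)
    from 1(9) 2 3 have "\<beta> = co \<alpha>" by (simp add: single_complementary)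
    moreover have "q = x" using 1(1) x by simp
    moreover have "q \<in> ?S" using 1(1,4) by (auto simp: ca_product_def)
    moreover have "q' = x[i := s0, j := r0]"
      unfolding 1(3) x 2 3 by (rule concat_update_singleton)
    moreover have "v = (replicate (length Ps) Idle)[i := \<alpha>, j := \<beta>]"
      unfolding 1(2) principals_idles[OF Ps] 2 3 by (rule concat_update_singleton)
    ultimately show thesis using 1 2 3 x i by (intro joint[of i j \<alpha> s0 r0]) auto
  next
    case 2
    then obtain x where x: "qs = map (\<lambda>s. [s]) x" "length x = length Ps"
      using principals_listset(1)[OF Ps] by auto
    from princ[OF 2(5)] 2(6) obtain \<alpha> s0 where 3: "u = [\<alpha>]" "s = [s0]" "\<alpha> \<noteq> Idle"
      by (blast elim: principal_trans)
    have "q = x" using 2(1) x by simp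
    moreover have "q \<in> ?S" using 2(1,4) by (auto simp: ca_product_def)
    moreover have "q' = x[i := s0]"
      unfolding 2(3) x 3 by (rule concat_update_singleton)
    moreover have "v = (replicate (length Ps) Idle)[i := \<alpha>]"
      unfolding 2(2) principals_idles[OF Ps] 3 by (rule concat_update_singleton)
    ultimately show thesis using 2 3 x by (intro solo[of i \<alpha> s0]) auto
  qed
qed

section \<open>Existence of joint and single moves in a product\<close>

lemma principals_lists:
  assumes Ps: "\<forall>P \<in> set Ps. principal P" and q: "q \<in> ca_states (ca_product Ps)"
  shows "map (\<lambda>s. [s]) q \<in> listset (map ca_states Ps)" "length q = length Ps"
  using q unfolding principals_listset(1)[OF Ps] product_states[OF Ps] by auto

lemma product_joint:
  assumes Ps: "\<forall>P \<in> set Ps. principal P" and q: "q \<in> ca_states (ca_product Ps)"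
    and ij: "i < j" "j < length Ps" "\<alpha> \<noteq> Idle"
    and "([q ! i], [\<alpha>], [s]) \<in> ca_trans (Ps ! i)" "([q ! j], [co \<alpha>], [r]) \<in> ca_trans (Ps ! j)"
  shows "(q, (replicate (length Ps) Idle)[i := \<alpha>, j := co \<alpha>], q[i := s, j := r]) \<in> ca_trans (ca_product Ps)"
proof -
  note * = principals_lists[OF Ps q] principals_idles[OF Ps]
  have "([q ! i], [\<alpha>], [s]) = (map (\<lambda>s. [s]) q ! i, [\<alpha>], [s])"
    "([q ! j], [co \<alpha>], [r]) = (map (\<lambda>s. [s]) q ! j, [co \<alpha>], [r])"
    using * ij by simp_all
  then show ?thesis
    unfolding product_trans_iff
    by (intro disjI1 exI[of _ "map (\<lambda>s. [s]) q"] exI[of _ i] exI[of _ j] exI[of _ "[\<alpha>]"]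
        exI[of _ "[co \<alpha>]"] exI[of _ "[s]"] exI[of _ "[r]"])
      (use assms * in \<open>simp_all add: concat_update_singleton single_complementary del: map_replicate\<close>)
qed

lemma product_solo:
  assumes Ps: "\<forall>P \<in> set Ps. principal P" and q: "q \<in> ca_states (ca_product Ps)"
    and i: "i < length Ps" "([q ! i], [\<alpha>], [s]) \<in> ca_trans (Ps ! i)"
    and free: "\<And>j r. j < length Ps \<Longrightarrow> j \<noteq> i \<Longrightarrow> ([q ! j], [co \<alpha>], [r]) \<notin> ca_trans (Ps ! j)"
  shows "(q, (replicate (length Ps) Idle)[i := \<alpha>], q[i := s]) \<in> ca_trans (ca_product Ps)"
proof -
  note * = principals_lists[OF Ps q] principals_idles[OF Ps]
  have "\<not> (\<exists>w r. (map (\<lambda>s. [s]) q ! j, w, r) \<in> ca_trans (Ps ! j) \<and> [\<alpha>] \<bowtie> w)"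
    if "j < length Ps" "j \<noteq> i" for j
  proof clarify
    fix w r assume wr: "(map (\<lambda>s. [s]) q ! j, w, r) \<in> ca_trans (Ps ! j)" "[\<alpha>] \<bowtie> w"
    have "principal (Ps ! j)" using Ps that(1) by simp
    with wr(1) obtain \<beta> r0 where "w = [\<beta>]" "r = [r0]"
      by (blast elim: principal_trans)
    with wr show False using free[OF that, of r0] * that by (simp add: single_complementary)
  qed
  then show ?thesis
    unfolding product_trans_iff
    by (intro disjI2 exI[of _ "map (\<lambda>s. [s]) q"] exI[of _ i] exI[of _ "[\<alpha>]"] exI[of _ "[s]"])
      (use assms * in \<open>simp_all add: concat_update_singleton del: map_replicate\<close>)
qed

text \<open>The product lists a joint move by increasing positions; since \<open>co\<close> is an
  involution, the other order is the same move read from its second participant.\<close>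

lemma product_match:
  assumes Ps: "\<forall>P \<in> set Ps. principal P" and q: "q \<in> ca_states (ca_product Ps)"
    and "i \<noteq> j" "i < length Ps" "j < length Ps" "\<alpha> \<noteq> Idle"
    and "([q ! i], [\<alpha>], [s]) \<in> ca_trans (Ps ! i)" "([q ! j], [co \<alpha>], [r]) \<in> ca_trans (Ps ! j)"
  shows "(q, (replicate (length Ps) Idle)[i := \<alpha>, j := co \<alpha>], q[i := s, j := r]) \<in> ca_trans (ca_product Ps)"
proof (cases "i < j")
  case False
  with assms product_joint[OF Ps q, of j i "co \<alpha>" r s] show ?thesis
    by (simp add: list_update_swap)
qed (use assms product_joint[OF Ps q] in blast)

lemma product_states_closed:
  assumes Ps: "\<forall>P \<in> set Ps. principal P" and "(q, v, q') \<in> ca_trans (ca_product Ps)"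
  shows "q \<in> ca_states (ca_product Ps)" "q' \<in> ca_states (ca_product Ps)"
proof -
  have tgt: "[s'] \<in> ca_states (Ps ! i)" if "i < length Ps" "([s], [\<alpha>], [s']) \<in> ca_trans (Ps ! i)" for i s \<alpha> s'
    using that Ps nth_mem[of i Ps] principal_trans[of "Ps ! i" "[s]" "[\<alpha>]" "[s']"] by blast
  from Ps assms(2) show "q \<in> ca_states (ca_product Ps)"
    by (rule product_trans_cases)
  from Ps assms(2) show "q' \<in> ca_states (ca_product Ps)"
    by (rule product_trans_cases) (auto simp: product_states[OF Ps] nth_list_update intro: tgt)
qed

section \<open>Projections of products of principals\<close>

text \<open>
  A projection only keeps the requests and offers that occur on transitions, which may lose
  some; these sets do not affect the language.
\<close>
definition core :: "('s, 'a) ca \<Rightarrow> ('s, 'a) ca" where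
  "core A = A\<lparr>ca_requests := {}, ca_offers := {}\<rparr>"

lemma core_simps [simp]:
  "ca_rank (core A) = ca_rank A" "ca_states (core A) = ca_states A" "ca_init (core A) = ca_init A"
  "ca_trans (core A) = ca_trans A" "ca_final (core A) = ca_final A"
  by (simp_all add: core_def)

lemma core_eq_iff:
  "core A = core B \<longleftrightarrow> ca_rank A = ca_rank B \<and> ca_states A = ca_states B \<and> ca_init A = ca_init B \<and>
     ca_trans A = ca_trans B \<and> ca_final A = ca_final B"
  by (cases A; cases B) (simp add: core_def)

lemma core_product:
  fixes As Bs :: "('s, 'a) ca list"
  assumes "map core As = map core Bs"
  shows "core (ca_product As) = core (ca_product Bs)"
proof -
  have "core (ca_product As) = core (ca_product (map core As))" for As :: "('s, 'a) ca list"
    by (auto simp: core_eq_iff ca_product_def ca_idles_def comp_def cong: conj_cong)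
  with assms show ?thesis by metis
qed

definition projections :: "('s, 'a) ca \<Rightarrow> ('s, 'a) ca list" where
  "projections A = map (ca_proj A) [0..<ca_rank A]"

lemma aproduct_eq: "ca_aproduct As = ca_product (concat (map projections As))"
  by (simp add: ca_aproduct_def projections_def[abs_def])

lemma core_projections:
  "core A = core B \<Longrightarrow> map core (projections A) = map core (projections B)"
  by (auto simp: projections_def core_eq_iff ca_proj_def ca_proj_trans_def)

text \<open>With a single component, projecting only unwraps and rewraps states and labels, and no
  transition is dropped as none is idle.\<close>

lemma projections_principal: 
  assumes "principal A"
  shows "map core (projections A) = [core A]"
proof -
  have single: "[q ! 0] = q" if "q \<in> ca_states A" for q
    using principal_single[OF assms that] by (cases q) auto
  then have "(\<lambda>q. [q ! 0]) ` S = S" if "S \<subseteq> ca_states A" for S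
    using that by (auto simp: image_iff subset_iff) 
  moreover have "ca_proj_trans A 0 = ca_trans A"
    unfolding ca_proj_trans_def
  proof (intro equalityI subsetI; clarify)
    fix q v q' assume "(q, v, q') \<in> ca_trans A" "v ! 0 \<noteq> Idle"
    with assms show "([q ! 0], [v ! 0], [q' ! 0]) \<in> ca_trans A"
      by (force elim: principal_trans)
  next
    fix q v q' assume *: "(q, v, q') \<in> ca_trans A"
    with assms obtain s \<alpha> s' where "q = [s]" "v = [\<alpha>]" "q' = [s']" "\<alpha> \<noteq> Idle"
      by (blast elim: principal_trans)
    with * show "\<exists>p u p'. (q, v, q') = ([p ! 0], [u ! 0], [p' ! 0]) \<and> (p, u, p') \<in> ca_trans A \<and> u ! 0 \<noteq> Idle"
      by force
  qed
  ultimately show ?thesis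
    using assms single unfolding principal_def
    by (auto simp: projections_def core_eq_iff ca_proj_def)
qed

text \<open>A given component is completed to a full tuple by arbitrary elements \<open>f k\<close>
  of the other factors, which is why all factors must be inhabited.\<close>

lemma component_states:
  assumes "\<forall>k < n. T k \<noteq> {}" "i < n" "\<And>k q. k < n \<Longrightarrow> q \<in> T k \<Longrightarrow> length q = 1"
  shows "(\<lambda>q. [q ! i]) ` {q. length q = n \<and> (\<forall>k < n. [q ! k] \<in> T k)} = T i"
proof (intro equalityI subsetI)
  fix x assume x: "x \<in> T i"
  obtain f where f: "\<forall>k < n. f k \<in> T k"
    using assms(1) by (intro that[of "\<lambda>k. SOME x. x \<in> T k"]) (simp add: some_in_eq)
  have single: "[hd q] = q" if "k < n" "q \<in> T k" for k q
    using assms(3)[OF that] by (cases q) auto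
  let ?q = "(map (hd \<circ> f) [0..<n])[i := hd x]"
  have "[?q ! k] \<in> T k" if "k < n" for k
    using that f x single assms(2) by (cases "k = i") auto
  then have "?q \<in> {q. length q = n \<and> (\<forall>k < n. [q ! k] \<in> T k)}" by simp
  then show "x \<in> (\<lambda>q. [q ! i]) ` {q. length q = n \<and> (\<forall>k < n. [q ! k] \<in> T k)}"
    by (rule rev_image_eqI) (use x single assms(2) in auto)
qed (use assms(2) in auto)

text \<open>Blocking loses no component transition. Place \<open>s\<close> at position
  \<open>i\<close> and the others in their initial states: either some other component has a
  complementary move and the joint move exists, or none has and the single move is free. Projection
  collects transitions from all states, reachable or not.\<close>

lemma product_proj_trans:
  assumes Ps: "\<forall>P \<in> set Ps. principal P" and i: "i < length Ps"
  shows "ca_proj_trans (ca_product Ps) i = ca_trans (Ps ! i)"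
proof (intro equalityI subsetI)
  fix x assume "x \<in> ca_proj_trans (ca_product Ps) i"
  then obtain q v q' where x: "x = ([q ! i], [v ! i], [q' ! i])" "v ! i \<noteq> Idle"
    and t: "(q, v, q') \<in> ca_trans (ca_product Ps)"
    by (auto simp: ca_proj_trans_def)
  from Ps t show "x \<in> ca_trans (Ps ! i)"
    by (rule product_trans_cases)
      (use x i in \<open>auto simp: product_states[OF Ps] nth_list_update split: if_splits\<close>)
next
  fix x assume x: "x \<in> ca_trans (Ps ! i)"
  have P: "principal (Ps ! i)" using Ps i by simp
  obtain p u p' where "x = (p, u, p')" by (cases x)
  with P x obtain s \<alpha> s' where x': "x = ([s], [\<alpha>], [s'])" "\<alpha> \<noteq> Idle" "[s] \<in> ca_states (Ps ! i)"
    by (blast elim: principal_trans)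
  define q where "q = (map (hd \<circ> ca_init) Ps)[i := s]"
  have q: "q \<in> ca_states (ca_product Ps)" and qi: "q ! i = s" and len: "length q = length Ps"
    using i x' Ps unfolding product_states[OF Ps] q_def
    by (auto simp: nth_list_update principal_init principalD(2))
  have "\<exists>v q'. (q, v, q') \<in> ca_trans (ca_product Ps) \<and> v ! i = \<alpha> \<and> q' ! i = s'"
  proof (cases "\<exists>j < length Ps. j \<noteq> i \<and> (\<exists>r. ([q ! j], [co \<alpha>], [r]) \<in> ca_trans (Ps ! j))")
    case True
    then obtain j r where "j < length Ps" "j \<noteq> i" "([q ! j], [co \<alpha>], [r]) \<in> ca_trans (Ps ! j)"
      by blast
    with product_match[OF Ps q, of i j \<alpha> s' r] i x x' qi len show ?thesis
      by (intro exI conjI) auto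
  next
    case False
    with product_solo[OF Ps q i, of \<alpha> s'] x x' qi i len show ?thesis
      by (intro exI conjI) auto
  qed
  with x' qi show "x \<in> ca_proj_trans (ca_product Ps) i"
    unfolding ca_proj_trans_def by force
qed

text \<open>Projecting undoes a product. Nested a-products therefore flatten into one product of
  clause automata.\<close>

lemma projections_product:
  assumes Ps: "\<forall>P \<in> set Ps. principal P"
  shows "map core (projections (ca_product Ps)) = map core Ps"
proof (rule nth_equalityI)
  fix i assume "i < length (map core (projections (ca_product Ps)))"
  then have i: "i < length Ps" by (simp add: projections_def product_rank[OF Ps])
  have P: "principal (Ps ! k)" if "k < length Ps" for k using Ps that by simp
  have "(\<lambda>q. [q ! i]) ` ca_states (ca_product Ps) = ca_states (Ps ! i)"
    unfolding product_states[OF Ps]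
    by (rule component_states[where T = "\<lambda>k. ca_states (Ps ! k)"])
      (use P i principalD principal_single in blast)+
  moreover have "(\<lambda>q. [q ! i]) ` ca_final (ca_product Ps) = ca_final (Ps ! i)"
    unfolding product_final[OF Ps]
    by (rule component_states[where T = "\<lambda>k. ca_final (Ps ! k)"])
      (use P i principalD principal_single in blast)+
  moreover have "[ca_init (ca_product Ps) ! i] = ca_init (Ps ! i)" "ca_rank (Ps ! i) = 1"
    using P[OF i] i by (auto simp: product_init[OF Ps] principal_init principalD)
  ultimately have "core (ca_proj (ca_product Ps) i) = core (Ps ! i)"
    by (simp add: core_eq_iff ca_proj_def product_proj_trans[OF Ps i])
  with i show "map core (projections (ca_product Ps)) ! i = map core Ps ! i"
    by (simp add: projections_def product_rank[OF Ps])
qed (simp add: projections_def product_rank[OF Ps])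

lemma core_path:
  fixes A B :: "('s, 'a) ca"
  assumes "core A = core B"
  shows "ca_path A q w q' \<longleftrightarrow> ca_path B q w q'"
proof -
  have "ca_path A q w q' \<Longrightarrow> core A = core B \<Longrightarrow> ca_path B q w q'" for A B :: "('s, 'a) ca"
    by (induction rule: ca_path.induct) (auto simp: core_eq_iff intro: ca_path.intros)
  with assms show ?thesis by metis
qed

lemma core_admits_agreement:
  assumes "core A = core B"
  shows "admits_agreement A Z \<longleftrightarrow> admits_agreement B Z"
proof -
  have "ca_language A = ca_language B"
    using assms core_path[OF assms] by (auto simp: ca_language_def core_eq_iff)
  then show ?thesis by (simp add: admits_agreement_def)
qed

section \<open>Automata of clauses\<close>

fun act :: "'a literal \<Rightarrow> 'a action" where
  "act (Positive a) = Off a"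
| "act (Negative a) = Req a"

lemma act_eq_Off_iff [simp]: "act l = Off a \<longleftrightarrow> l = Positive a"
  by (cases l) auto

lemma act_eq_Req_iff [simp]: "act l = Req a \<longleftrightarrow> l = Negative a"
  by (cases l) auto

lemmas eq_act_iff [simp] = act_eq_Off_iff[THEN eq_iff_swap] act_eq_Req_iff[THEN eq_iff_swap]

lemma act_neq_Idle [simp]: "act l \<noteq> Idle"
  by (cases l) auto

lemma tensor_states_iff: "q \<in> tensor_states X \<longleftrightarrow> None \<in> q \<and> q \<subseteq> insert None (Some ` X)"
proof
  assume "None \<in> q \<and> q \<subseteq> insert None (Some ` X)"
  then have "q = insert None (Some ` {l. Some l \<in> q})" "{l. Some l \<in> q} \<subseteq> X"
    by (auto simp: image_iff)
  then show "q \<in> tensor_states X" unfolding tensor_states_def by blast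
qed (auto simp: tensor_states_def)

lemma tensor_states_diff: "q \<in> tensor_states X \<Longrightarrow> q - {Some l} \<in> tensor_states X"
  by (auto simp: tensor_states_iff)

lemma tensor_states_literal: "q \<in> tensor_states X \<Longrightarrow> Some l \<in> q \<Longrightarrow> l \<in> X"
  by (auto simp: tensor_states_iff)

lemma tensor_trans_iff:
  "(p, v, p') \<in> ca_trans (tensor_ca X) \<longleftrightarrow>
     (\<exists>q l. p = [q] \<and> v = [act l] \<and> p' = [q - {Some l}] \<and> q \<in> tensor_states X \<and> Some l \<in> q)"
    (is "?L \<longleftrightarrow> ?R")
proof
  assume ?L
  then consider
    (1) a Z where "p = [insert (Some (Negative a)) Z]" "v = [Req a]" "p' = [Z]"
      "insert (Some (Negative a)) Z \<in> tensor_states X" "Some (Negative a) \<notin> Z"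
    | (2) a Z where "p = [insert (Some (Positive a)) Z]" "v = [Off a]" "p' = [Z]"
      "insert (Some (Positive a)) Z \<in> tensor_states X" "Some (Positive a) \<notin> Z"
    by (auto simp: tensor_ca_def)
  then show ?R
  proof cases
    case 1
    then show ?thesis
      by (intro exI[of _ "insert (Some (Negative a)) Z"] exI[of _ "Negative a"]) simp
  next
    case 2
    then show ?thesis
      by (intro exI[of _ "insert (Some (Positive a)) Z"] exI[of _ "Positive a"]) simp
  qed
next
  assume ?R
  then obtain q l where *: "p = [q]" "v = [act l]" "p' = [q - {Some l}]" "q \<in> tensor_states X" "Some l \<in> q"
    by blast
  then have "q = insert (Some l) (q - {Some l})" "l \<in> X" by (auto dest: tensor_states_literal)
  with * show ?L by (cases l) (auto simp: tensor_ca_def)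
qed

lemma rename_trans_iff:
  "(p, v, p') \<in> ca_trans (ca_rename f A) \<longleftrightarrow> (\<exists>q q'. p = map f q \<and> p' = map f q' \<and> (q, v, q') \<in> ca_trans A)"
  by (force simp: ca_rename_def)

lemma rename_tensor_trans_iff:
  "(p, v, p') \<in> ca_trans (ca_rename f (tensor_ca X)) \<longleftrightarrow>
     (\<exists>q l. p = [f q] \<and> v = [act l] \<and> p' = [f (q - {Some l})] \<and> q \<in> tensor_states X \<and> Some l \<in> q)"
proof
  assume "(p, v, p') \<in> ca_trans (ca_rename f (tensor_ca X))"
  then obtain q l where "p = map f [q]" "p' = map f [q - {Some l}]" "v = [act l]"
      "q \<in> tensor_states X" "Some l \<in> q"
    unfolding rename_trans_iff tensor_trans_iff by blast
  then show "\<exists>q l. p = [f q] \<and> v = [act l] \<and> p' = [f (q - {Some l})] \<and> q \<in> tensor_states X \<and> Some l \<in> q"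
    by (intro exI[of _ q] exI[of _ l]) simp
next
  assume "\<exists>q l. p = [f q] \<and> v = [act l] \<and> p' = [f (q - {Some l})] \<and> q \<in> tensor_states X \<and> Some l \<in> q"
  then obtain q l where "p = map f [q]" "p' = map f [q - {Some l}]" "v = [act l]"
      "q \<in> tensor_states X" "Some l \<in> q"
    by auto
  then show "(p, v, p') \<in> ca_trans (ca_rename f (tensor_ca X))"
    unfolding rename_trans_iff tensor_trans_iff by blast
qed

lemma TensorClause_trans_iff:
  "(p, v, p') \<in> ca_trans (clause_ca (TensorClause X)) \<longleftrightarrow>
     (\<exists>q l. p = [Inr q] \<and> v = [act l] \<and> p' = [Inr (q - {Some l})] \<and>
        q \<in> tensor_states (set X) \<and> Some l \<in> q)"
  by (simp add: rename_tensor_trans_iff)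

text \<open>The premise automaton enters its final state \<open>{None}\<close> exactly by its last
  request, so concatenation cuts its transitions into those with requests left and those redirected
  to the full conclusion. The tags keep the premise's \<open>{None}\<close> apart from the
  conclusion's.\<close>

lemma ImpClause_trans_iff:
  "(p, v, p') \<in> ca_trans (clause_ca (ImpClause Y X)) \<longleftrightarrow>
     (\<exists>q l. p = [Inr q] \<and> v = [act l] \<and> p' = [Inr (q - {Some l})] \<and>
        q \<in> tensor_states (set X) \<and> Some l \<in> q) \<or>
     (\<exists>q b. p = [Inl q] \<and> v = [Req b] \<and> p' = [Inl (q - {Some (Negative b)})] \<and>
        q \<in> tensor_states (Negative ` set Y) \<and> Some (Negative b) \<in> q \<and>
        q - {Some (Negative b)} \<noteq> {None}) \<or>
     (\<exists>q b. p = [Inl q] \<and> v = [Req b] \<and> p' = [Inr (insert None (Some ` set X))] \<and>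
        q \<in> tensor_states (Negative ` set Y) \<and> Some (Negative b) \<in> q \<and>
        q - {Some (Negative b)} = {None})"
    (is "_ \<longleftrightarrow> ?R \<or> ?L \<or> ?M")
proof -
  let ?A = "ca_rename Inl (tensor_ca (Negative ` set Y)) :: ('a principal_state, 'a) ca"
  let ?B = "ca_rename Inr (tensor_ca (set X)) :: ('a principal_state, 'a) ca"
  have final: "ca_final ?A = {[Inl {None}]}" and init: "ca_init ?B = [Inr (insert None (Some ` set X))]"
    by (simp_all add: ca_rename_def tensor_ca_def)
  have B: "(p, v, p') \<in> ca_trans ?B \<longleftrightarrow> ?R"
    by (simp add: rename_tensor_trans_iff)
  have A: "(p, v, p') \<in> ca_trans ?A \<longleftrightarrow> (\<exists>q b. p = [Inl q] \<and> v = [Req b] \<and> p' = [Inl (q - {Some (Negative b)})] \<and>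
        q \<in> tensor_states (Negative ` set Y) \<and> Some (Negative b) \<in> q)" for p'
  proof
    assume "(p, v, p') \<in> ca_trans ?A"
    then obtain q l where *: "p = [Inl q]" "v = [act l]" "p' = [Inl (q - {Some l})]"
        "q \<in> tensor_states (Negative ` set Y)" "Some l \<in> q"
      by (auto simp: rename_tensor_trans_iff)
    moreover from *(4,5) obtain b where "l = Negative b" by (auto dest: tensor_states_literal)
    ultimately show "\<exists>q b. p = [Inl q] \<and> v = [Req b] \<and> p' = [Inl (q - {Some (Negative b)})] \<and>
        q \<in> tensor_states (Negative ` set Y) \<and> Some (Negative b) \<in> q" by auto
  next
    assume "\<exists>q b. p = [Inl q] \<and> v = [Req b] \<and> p' = [Inl (q - {Some (Negative b)})] \<and>
        q \<in> tensor_states (Negative ` set Y) \<and> Some (Negative b) \<in> q"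
    then show "(p, v, p') \<in> ca_trans ?A"
      unfolding rename_tensor_trans_iff by (metis act.simps(2))
  qed
  have "(p, v, p') \<in> ca_trans (clause_ca (ImpClause Y X)) \<longleftrightarrow>
      (p, v, p') \<in> ca_trans ?A \<and> p' \<notin> ca_final ?A \<or> (p, v, p') \<in> ca_trans ?B \<or>
      (\<exists>q'. (p, v, q') \<in> ca_trans ?A \<and> q' \<in> ca_final ?A \<and> p' = ca_init ?B)"
    by (auto simp: ca_concat_def)
  moreover have "(p, v, p') \<in> ca_trans ?A \<and> p' \<notin> ca_final ?A \<longleftrightarrow> ?L"
    unfolding final A by auto
  moreover have "(\<exists>q'. (p, v, q') \<in> ca_trans ?A \<and> q' \<in> ca_final ?A \<and> p' = ca_init ?B) \<longleftrightarrow> ?M"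
    unfolding final init A by auto
  ultimately show ?thesis unfolding B by argo
qed

lemma clause_states:
  "[s] \<in> ca_states (clause_ca (TensorClause X)) \<longleftrightarrow> (\<exists>q. s = Inr q \<and> q \<in> tensor_states (set X))"
  "[s] \<in> ca_states (clause_ca (ImpClause Y X)) \<longleftrightarrow>
     (\<exists>q. s = Inr q \<and> q \<in> tensor_states (set X)) \<or> (\<exists>q. s = Inl q \<and> q \<in> tensor_states (Negative ` set Y))"
  by (auto simp: ca_concat_def ca_rename_def tensor_ca_def image_image)

lemma clause_final: "ca_final (clause_ca \<alpha>) = {[Inr {None}]}"
  by (cases \<alpha>) (auto simp: ca_concat_def ca_rename_def tensor_ca_def)

lemma clause_init:
  "ca_init (clause_ca (TensorClause X)) = [Inr (insert None (Some ` set X))]"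
  "ca_init (clause_ca (ImpClause Y X)) = [Inl (insert None (Some ` Negative ` set Y))]"
  by (simp_all add: ca_concat_def ca_rename_def tensor_ca_def)

lemma clause_trans_states:
  assumes "(q, v, q') \<in> ca_trans (clause_ca \<alpha>)"
  shows "q \<in> ca_states (clause_ca \<alpha>) \<and> q' \<in> ca_states (clause_ca \<alpha>) \<and> (\<exists>\<alpha>. \<alpha> \<noteq> Idle \<and> v = [\<alpha>])"
proof (cases \<alpha>)
  case (TensorClause X)
  with assms obtain p l where "q = [Inr p]" "v = [act l]" "q' = [Inr (p - {Some l})]"
      "p \<in> tensor_states (set X)"
    unfolding TensorClause TensorClause_trans_iff by blast
  then show ?thesis unfolding TensorClause by (simp add: clause_states tensor_states_diff del: clause_ca.simps)
next
  case (ImpClause Y X)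
  have full: "insert None (Some ` set X) \<in> tensor_states (set X)" by (simp add: tensor_states_iff)
  from assms[unfolded ImpClause ImpClause_trans_iff] show ?thesis
    unfolding ImpClause
    by (elim disjE exE conjE) (simp_all add: clause_states tensor_states_diff full del: clause_ca.simps)
qed

lemma principal_clause: "principal (clause_ca \<alpha>)"
  unfolding principal_def
proof (intro conjI)
  show "ca_rank (clause_ca \<alpha>) = 1" "\<forall>q \<in> ca_states (clause_ca \<alpha>). length q = 1"
    by (cases \<alpha>; auto simp: ca_concat_def ca_rename_def tensor_ca_def)+
  show "ca_init (clause_ca \<alpha>) \<in> ca_states (clause_ca \<alpha>)"
    by (cases \<alpha>) (auto simp: clause_init clause_states tensor_states_iff simp del: clause_ca.simps)
  show "ca_final (clause_ca \<alpha>) \<subseteq> ca_states (clause_ca \<alpha>)"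
    by (cases \<alpha>) (auto simp: clause_final clause_states tensor_states_iff simp del: clause_ca.simps)
qed (use clause_trans_states in \<open>auto simp: clause_final\<close>)

lemma principal_clauses: "\<forall>P \<in> set (map clause_ca \<alpha>s). principal P"
  by (auto simp: principal_clause)

lemma projections_horn_ca: "map core (projections (horn_ca p)) = map core (map clause_ca (clauses p))"
proof (cases p)
  case (Horn \<alpha>s)
  have "map core (concat (map projections As)) = map core As" if "\<forall>P \<in> set As. principal P"
    for As :: "('a principal_state, 'a) ca list"
    using that by (induction As) (auto simp: projections_principal)
  from core_product[OF this[OF principal_clauses]]
  have "core (horn_ca p) = core (ca_product (map clause_ca \<alpha>s))"
    using Horn by (simp add: aproduct_eq)
  from core_projections[OF this] Horn show ?thesis
    by (simp only: projections_product[OF principal_clauses] clauses.simps)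
next
  case (Clause \<alpha>)
  then show ?thesis using projections_principal[OF principal_clause] by simp
qed

text \<open>The empty list is excluded since \<open>ca_product []\<close> accepts the empty word,
  whereas \<open>empty_ca\<close> accepts nothing. As the tail of a list \<open>empty_ca\<close>
  does no harm: having rank 0, it has no projections.\<close>

lemma core_horns_ca:
  "\<Gamma>s \<noteq> [] \<Longrightarrow> core (horns_ca \<Gamma>s) = core (ca_product (map clause_ca (concat (map clauses \<Gamma>s))))"
proof (induction \<Gamma>s)
  case (Cons p \<Gamma>s)
  have "map core (projections (horns_ca \<Gamma>s)) = map core (map clause_ca (concat (map clauses \<Gamma>s)))"
  proof (cases "\<Gamma>s = []")
    case True
    then show ?thesis by (simp add: projections_def empty_ca_def)
  next
    case False
    from core_projections[OF Cons.IH[OF this]] show ?thesis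
      by (simp only: projections_product[OF principal_clauses])
  qed
  then show ?case
    using core_product[of "projections (horn_ca p) @ projections (horns_ca \<Gamma>s)"
        "map clause_ca (clauses p) @ map clause_ca (concat (map clauses \<Gamma>s))"]
      projections_horn_ca[of p]
    by (simp add: aproduct_eq)
qed simp

section \<open>Residual resources of a state\<close>

definition left_literals :: "'a literal list \<Rightarrow> 'a literal option set \<Rightarrow> 'a literal list" where
  "left_literals X q = filter (\<lambda>l. Some l \<in> q) X"

definition left_atoms :: "'a list \<Rightarrow> 'a literal option set \<Rightarrow> 'a list" where
  "left_atoms Y q = filter (\<lambda>b. Some (Negative b) \<in> q) Y"

text \<open>\<open>Inl\<close> means that the premise is still being requested, \<open>Inr\<close>
  that the literals themselves are being used up. The automaton of a tensor clause has no
  \<open>Inl\<close> states, so \<open>{#}\<close> is a default value there.\<close>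

fun residual :: "'a clause \<Rightarrow> 'a principal_state \<Rightarrow> 'a resource multiset" where
  "residual (TensorClause X) (Inr q) = lits (left_literals X q)"
| "residual (TensorClause X) (Inl q) = {#}"
| "residual (ImpClause Y X) (Inr q) = lits (left_literals X q)"
| "residual (ImpClause Y X) (Inl q) = {#Pending (left_atoms Y q) X#}"

text \<open>A state is a set, so a transition deletes every copy of its literal; distinctness makes
  this the deletion of a single resource.\<close>

lemma left_literals_diff:
  "distinct X \<Longrightarrow> l \<in> set X \<Longrightarrow> Some l \<in> q \<Longrightarrow>
     lits (left_literals X q) = add_mset (Lit l) (lits (left_literals X (q - {Some l})))"
proof (induction X)
  case (Cons x X)
  show ?case
  proof (cases "x = l")
    case True
    with Cons.prems have "left_literals X (q - {Some l}) = left_literals X q"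
      by (auto simp: left_literals_def intro: filter_cong)
    with True Cons.prems show ?thesis by (simp add: left_literals_def)
  qed (use Cons in \<open>auto simp: left_literals_def\<close>)
qed simp

lemma left_atoms_diff: 
  "distinct Y \<Longrightarrow> left_atoms Y (q - {Some (Negative a)}) = remove1 a (left_atoms Y q)"
proof (induction Y)
  case (Cons y Y)
  show ?case
  proof (cases "y = a")
    case True
    with Cons.prems have "left_atoms Y (q - {Some (Negative a)}) = left_atoms Y q" "a \<notin> set (left_atoms Y q)"
      by (auto simp: left_atoms_def intro: filter_cong)
    with True show ?thesis by (auto simp: left_atoms_def remove1_idem)
  qed (use Cons in \<open>auto simp: left_atoms_def\<close>)
qed (simp add: left_atoms_def)

lemma left_atoms_empty_iff:
  "q \<in> tensor_states (Negative ` set Y) \<Longrightarrow> left_atoms Y q = [] \<longleftrightarrow> q = {None}"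
  by (auto simp: left_atoms_def tensor_states_iff filter_empty_conv)

lemma left_literals_empty_iff:
  "q \<in> tensor_states (set X) \<Longrightarrow> left_literals X q = [] \<longleftrightarrow> q = {None}"
  by (auto simp: left_literals_def tensor_states_iff filter_empty_conv)

lemma left_literals_all: "left_literals X (insert None (Some ` set X)) = X"
  by (simp add: left_literals_def)

lemma left_atoms_all: "left_atoms Y (insert None (Some ` Negative ` set Y)) = Y"
  by (simp add: left_atoms_def image_image)

lemma residual_offer:
  assumes "wf_clause \<alpha>" "([s], [Off a], [s']) \<in> ca_trans (clause_ca \<alpha>)"
  shows "residual \<alpha> s = add_mset (Lit (Positive a)) (residual \<alpha> s')"
  using assms
  by (cases \<alpha>) (auto simp: TensorClause_trans_iff ImpClause_trans_iff literal_product_def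
      simp del: clause_ca.simps intro!: left_literals_diff dest: tensor_states_literal)

text \<open>A request comes from a negative literal, from a premise atom with others remaining, or
  from the last premise atom. These are the three rules of \<open>consume\<close>.\<close>

lemma residual_request:
  assumes "wf_clause \<alpha>" "([s], [Req a], [s']) \<in> ca_trans (clause_ca \<alpha>)"
  obtains K r N where "residual \<alpha> s = add_mset r K" "consume a r N" "residual \<alpha> s' = K + N"
proof (cases "\<exists>q. s = Inl q")
  case False
  then have "residual \<alpha> s = add_mset (Lit (Negative a)) (residual \<alpha> s')"
    using assms by (cases \<alpha>) (auto simp: TensorClause_trans_iff ImpClause_trans_iff literal_product_def
      simp del: clause_ca.simps intro!: left_literals_diff dest: tensor_states_literal)
  with that[OF this consume_Negative] show thesis by simp
next
  case True
  with assms obtain q Y X where \<alpha>: "\<alpha> = ImpClause Y X" and q: "s = Inl q"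
      "q \<in> tensor_states (Negative ` set Y)" "Some (Negative a) \<in> q"
    and s': "q - {Some (Negative a)} = {None} \<Longrightarrow> s' = Inr (insert None (Some ` set X))"
      "q - {Some (Negative a)} \<noteq> {None} \<Longrightarrow> s' = Inl (q - {Some (Negative a)})"
    by (cases \<alpha>) (auto simp: TensorClause_trans_iff ImpClause_trans_iff simp del: clause_ca.simps)
  let ?ys = "left_atoms Y q"
  have wf: "distinct Y" "X \<noteq> []" using assms(1) \<alpha> by (auto simp: literal_product_def)
  have a: "a \<in> set ?ys" using q by (auto simp: left_atoms_def dest: tensor_states_literal)
  \<comment> \<open>The two case distinctions coincide: the list of remaining premise atoms becomes
    empty exactly when the transition would enter the final state of the premise automaton.\<close>
  have rem: "remove1 a ?ys = [] \<longleftrightarrow> q - {Some (Negative a)} = {None}"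
    using left_atoms_empty_iff[OF tensor_states_diff[OF q(2)], of "Negative a"]
    by (simp add: left_atoms_diff[OF wf(1)])
  show thesis
  proof (cases "remove1 a ?ys = []")
    case True
    with a have "?ys = [a]" by (cases ?ys) (auto split: if_splits)
    moreover from True rem have "s' = Inr (insert None (Some ` set X))" using s' by simp
    ultimately show thesis
      using \<alpha> q consume_last[OF wf(2)] by (intro that[of _ "{#}"]) (auto simp: left_literals_all)
  next
    case False
    with rem s' have "s' = Inl (q - {Some (Negative a)})" by simp
    then show thesis
      using \<alpha> q consume_Pending[OF a False] by (intro that[of _ "{#}"]) (auto simp: left_atoms_diff[OF wf(1)])
  qed
qed

lemma literal_possible:
  assumes "[s] \<in> ca_states (clause_ca \<alpha>)" "Lit l \<in># residual \<alpha> s"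
  obtains s' where "([s], [act l], [s']) \<in> ca_trans (clause_ca \<alpha>)"
proof -
  from assms(2) obtain q where q: "s = Inr q" "Some l \<in> q"
    by (cases \<alpha>; cases s) (auto simp: left_literals_def)
  have "([s], [act l], [Inr (q - {Some l})]) \<in> ca_trans (clause_ca \<alpha>)"
  proof (cases \<alpha>)
    case (TensorClause X)
    with assms(1) q have "q \<in> tensor_states (set X)" by (simp add: clause_states del: clause_ca.simps)
    with q show ?thesis unfolding TensorClause TensorClause_trans_iff by blast
  next
    case (ImpClause Y X)
    with assms(1) q have "q \<in> tensor_states (set X)" by (simp add: clause_states del: clause_ca.simps)
    with q show ?thesis unfolding ImpClause ImpClause_trans_iff by blast
  qed
  with that show thesis .
qed

text \<open>The third assumption forces an \<open>Inr\<close> state; in an \<open>Inl\<close> state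
  a transition with the same label would serve a premise atom instead.\<close>

lemma residual_literal:
  assumes "wf_clause \<alpha>" "([s], [act l], [s']) \<in> ca_trans (clause_ca \<alpha>)" "Lit l \<in># residual \<alpha> s"
  shows "residual \<alpha> s = add_mset (Lit l) (residual \<alpha> s')"
proof -
  from assms(3) obtain q where q: "s = Inr q" "Some l \<in> q"
    by (cases \<alpha>; cases s) (auto simp: left_literals_def)
  have act: "act l = act k \<longleftrightarrow> l = k" for k by (cases l; cases k) auto
  show ?thesis
  proof (cases \<alpha>)
    case (TensorClause X)
    with assms q show ?thesis
      by (auto simp: TensorClause_trans_iff literal_product_def act simp del: clause_ca.simps
          intro!: left_literals_diff dest: tensor_states_literal)
  next
    case (ImpClause Y X)
    with assms q show ?thesis
      by (auto simp: ImpClause_trans_iff literal_product_def act simp del: clause_ca.simps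
          intro!: left_literals_diff dest: tensor_states_literal)
  qed
qed

text \<open>Converse to \<open>residual_request\<close>: whatever resource of the state a reduction
  wants to feed, the automaton has a transition that feeds precisely this one.\<close>

lemma request_possible:
  assumes wf: "wf_clause \<alpha>" and s: "[s] \<in> ca_states (clause_ca \<alpha>)"
    and r: "r \<in># residual \<alpha> s" "consume a r N"
  obtains s' where "([s], [Req a], [s']) \<in> ca_trans (clause_ca \<alpha>)"
    "residual \<alpha> s' = residual \<alpha> s - {#r#} + N"
  using r(2)
proof cases
  case consume_Negative
  with r(1) have l: "Lit (Negative a) \<in># residual \<alpha> s" by simp
  from literal_possible[OF s l] obtain s' where s': "([s], [Req a], [s']) \<in> ca_trans (clause_ca \<alpha>)"
    by auto
  then have "residual \<alpha> s = add_mset r (residual \<alpha> s')"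
    using residual_literal[OF wf, of s "Negative a" s'] l consume_Negative by simp
  with s' consume_Negative that show thesis by simp
next
  case (consume_Pending ys xs)
  with r(1) s obtain q Y X where \<alpha>: "\<alpha> = ImpClause Y X" and q: "s = Inl q"
      "q \<in> tensor_states (Negative ` set Y)" "ys = left_atoms Y q" "xs = X"
    by (cases \<alpha>) (auto simp: clause_states simp del: clause_ca.simps)
  have wf': "distinct Y" using wf \<alpha> by simp
  have "Some (Negative a) \<in> q" using consume_Pending q by (auto simp: left_atoms_def)
  moreover have "q - {Some (Negative a)} \<noteq> {None}"
    using left_atoms_empty_iff[OF tensor_states_diff[OF q(2)], of "Negative a"] consume_Pending q
    by (simp add: left_atoms_diff[OF wf'])
  ultimately have "([s], [Req a], [Inl (q - {Some (Negative a)})]) \<in> ca_trans (clause_ca \<alpha>)"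
    unfolding \<alpha> ImpClause_trans_iff using q by blast
  then show thesis
    using consume_Pending q \<alpha> by (intro that) (auto simp: left_atoms_diff[OF wf'])
next
  case (consume_last xs)
  with r(1) s obtain q Y X where \<alpha>: "\<alpha> = ImpClause Y X" and q: "s = Inl q"
      "q \<in> tensor_states (Negative ` set Y)" "[a] = left_atoms Y q" "xs = X"
    by (cases \<alpha>) (auto simp: clause_states simp del: clause_ca.simps)
  have wf': "distinct Y" using wf \<alpha> by simp
  have "a \<in> set (left_atoms Y q)" unfolding q(3)[symmetric] by simp
  then have "Some (Negative a) \<in> q" by (simp add: left_atoms_def)
  moreover have "q - {Some (Negative a)} = {None}"
    using left_atoms_empty_iff[OF tensor_states_diff[OF q(2)], of "Negative a"]
    by (simp add: left_atoms_diff[OF wf'] flip: q(3))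
  ultimately have "([s], [Req a], [Inr (insert None (Some ` set X))]) \<in> ca_trans (clause_ca \<alpha>)"
    unfolding \<alpha> ImpClause_trans_iff using q by blast
  then show thesis
    using consume_last q \<alpha> by (intro that) (auto simp: left_literals_all)
qed

text \<open>Guarantees that the two resources of a reduction step belong to different principals, as
  a match requires. A tensor never contains an atom together with its negation, and a pending
  implication is alone in its residual.\<close>

lemma offer_request_exclusive:
  assumes "wf_clause \<alpha>" "Lit (Positive a) \<in># residual \<alpha> s" "r \<in># residual \<alpha> s"
  shows "\<not> consume a r N"
  using assms
  by (cases \<alpha>; cases s) (auto simp: left_literals_def literal_product_def elim!: consume.cases)

lemma clause_final_iff:
  assumes "[s] \<in> ca_states (clause_ca \<alpha>)"
  shows "[s] \<in> ca_final (clause_ca \<alpha>) \<longleftrightarrow> residual \<alpha> s = {#}"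
  using assms
  by (cases \<alpha>)
    (auto simp: clause_states clause_final left_literals_empty_iff simp del: clause_ca.simps)

lemma residual_init: "residual \<alpha> (hd (ca_init (clause_ca \<alpha>))) = clause_resources \<alpha>"
  by (cases \<alpha>) (simp_all add: clause_init left_literals_all left_atoms_all del: clause_ca.simps)

section \<open>Labels of a product of principals\<close>

lemma solo_label:
  "i < n \<Longrightarrow> (replicate n Idle)[i := \<alpha>] = replicate i Idle @ [\<alpha>] @ replicate (n - Suc i) Idle"
  by (rule nth_equalityI) (auto simp: nth_append nth_list_update nth_Cons')

lemma joint_label:
  "i < j \<Longrightarrow> j < n \<Longrightarrow> (replicate n Idle)[i := \<alpha>, j := \<beta>] =
     replicate i Idle @ [\<alpha>] @ replicate (j - Suc i) Idle @ [\<beta>] @ replicate (n - Suc j) Idle"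
  by (rule nth_equalityI) (auto simp: nth_append nth_list_update nth_Cons')

text \<open>The number of entries that are not idle, one for an offer and two for a match, tells the
  labels apart whatever the padding.\<close>

lemma offer_on_active: "offer_on \<alpha> v \<Longrightarrow> filter (\<lambda>x. x \<noteq> Idle) v = [\<alpha>]"
  by (auto simp: offer_on_def)

lemma match_label_active: "match_label v \<Longrightarrow> length (filter (\<lambda>x. x \<noteq> Idle) v) = 2"
  by (auto simp: match_label_def)

lemma solo_label_active:
  "i < n \<Longrightarrow> \<alpha> \<noteq> Idle \<Longrightarrow> filter (\<lambda>x. x \<noteq> Idle) ((replicate n Idle)[i := \<alpha>]) = [\<alpha>]"
  by (simp add: solo_label)

lemma offer_on_solo_iff:
  assumes "i < n" "\<alpha> \<noteq> Idle"
  shows "offer_on \<beta> ((replicate n Idle)[i := \<alpha>]) \<longleftrightarrow> \<beta> = \<alpha> \<and> (\<exists>a. \<alpha> = Off a)"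
proof
  assume "offer_on \<beta> ((replicate n Idle)[i := \<alpha>])"
  with offer_on_active[OF this] solo_label_active[OF assms] show "\<beta> = \<alpha> \<and> (\<exists>a. \<alpha> = Off a)"
    by (auto simp: offer_on_def)
next
  assume "\<beta> = \<alpha> \<and> (\<exists>a. \<alpha> = Off a)"
  with assms show "offer_on \<beta> ((replicate n Idle)[i := \<alpha>])"
    unfolding offer_on_def by (auto simp only: solo_label)
qed

lemma not_match_solo: "i < n \<Longrightarrow> \<alpha> \<noteq> Idle \<Longrightarrow> \<not> match_label ((replicate n Idle)[i := \<alpha>])"
  using match_label_active[of "(replicate n Idle)[i := \<alpha>]"] by (auto simp: solo_label_active)

lemma match_joint_less:
  assumes "i < j" "j < n" "\<alpha> \<noteq> Idle"
  shows "match_label ((replicate n Idle)[i := \<alpha>, j := co \<alpha>])"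
  unfolding match_label_def joint_label[OF assms(1,2)] using assms(3) by blast

lemma match_joint:
  assumes "i \<noteq> j" "i < n" "j < n" "\<alpha> \<noteq> Idle"
  shows "match_label ((replicate n Idle)[i := \<alpha>, j := co \<alpha>])"
proof (cases "i < j")
  case False
  with assms match_joint_less[of j i n "co \<alpha>"] show ?thesis by (simp add: list_update_swap)
qed (use assms match_joint_less in blast)

lemma match_not_offer: "match_label v \<Longrightarrow> \<not> offer_on \<alpha> v"
  using match_label_active offer_on_active by fastforce

section \<open>Runs and reductions\<close>

abbreviation clauses_ca :: "'a clause list \<Rightarrow> ('a principal_state, 'a) ca" where
  "clauses_ca \<alpha>s \<equiv> ca_product (map clause_ca \<alpha>s)"

definition residuals :: "'a clause list \<Rightarrow> 'a principal_state list \<Rightarrow> 'a resource multiset" where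
  "residuals \<alpha>s q = (\<Sum>i < length \<alpha>s. residual (\<alpha>s ! i) (q ! i))"

text \<open>The remainder \<open>R\<close> does not depend on the new state, so the effect of a move
  is the difference between two residuals of a single component.\<close>

lemma residuals_update:
  assumes "i < length \<alpha>s" "length q = length \<alpha>s"
  obtains R where "\<And>s. residuals \<alpha>s (q[i := s]) = R + residual (\<alpha>s ! i) s"
    "residuals \<alpha>s q = R + residual (\<alpha>s ! i) (q ! i)"
proof -
  let ?R = "\<Sum>k \<in> {..<length \<alpha>s} - {i}. residual (\<alpha>s ! k) (q ! k)"
  have *: "residuals \<alpha>s (q[i := s]) = ?R + residual (\<alpha>s ! i) s" for s
  proof -
    have "(\<Sum>k \<in> {..<length \<alpha>s} - {i}. residual (\<alpha>s ! k) (q[i := s] ! k)) = ?R"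
      by (rule sum.cong) auto
    then show ?thesis
      unfolding residuals_def using assms by (subst sum.remove[of _ i]) auto
  qed
  from *[of "q ! i"] have "residuals \<alpha>s q = ?R + residual (\<alpha>s ! i) (q ! i)" by simp
  with * that show thesis by blast
qed

lemma residuals_component:
  "r \<in># residuals \<alpha>s q \<longleftrightarrow> (\<exists>i < length \<alpha>s. r \<in># residual (\<alpha>s ! i) (q ! i))"
  by (auto simp: residuals_def set_mset_sum)

lemma residuals_empty_iff:
  "residuals \<alpha>s q = {#} \<longleftrightarrow> (\<forall>i < length \<alpha>s. residual (\<alpha>s ! i) (q ! i) = {#})"
proof -
  have "residuals \<alpha>s q = {#} \<longleftrightarrow> set_mset (residuals \<alpha>s q) = {}" by simp
  also have "\<dots> \<longleftrightarrow> (\<forall>i < length \<alpha>s. set_mset (residual (\<alpha>s ! i) (q ! i)) = {})"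
    unfolding set_eq_iff residuals_component by blast
  finally show ?thesis by simp
qed

lemma residuals_init: "residuals \<alpha>s (ca_init (clauses_ca \<alpha>s)) = clauses_resources \<alpha>s"
  unfolding product_init[OF principal_clauses] residuals_def
  by (simp add: residual_init sum_list_sum_nth atLeast0LessThan)

lemma init_state: "ca_init (clauses_ca \<alpha>s) \<in> ca_states (clauses_ca \<alpha>s)"
  unfolding product_init[OF principal_clauses] product_states[OF principal_clauses]
  by (simp add: principal_init[OF principal_clause] principalD(2)[OF principal_clause])

lemma final_iff:
  assumes "q \<in> ca_states (clauses_ca \<alpha>s)"
  shows "q \<in> ca_final (clauses_ca \<alpha>s) \<longleftrightarrow> residuals \<alpha>s q = {#}"
  using assms unfolding product_final[OF principal_clauses] product_states[OF principal_clauses] residuals_empty_iff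
  by (auto simp: clause_final_iff)

lemma residuals_match:
  assumes wf: "\<forall>\<alpha> \<in> set \<alpha>s. wf_clause \<alpha>" and len: "length q = length \<alpha>s"
    and ij: "i \<noteq> j" "i < length \<alpha>s" "j < length \<alpha>s"
    and i: "([q ! i], [Off a], [s]) \<in> ca_trans (clause_ca (\<alpha>s ! i))"
    and j: "([q ! j], [Req a], [s']) \<in> ca_trans (clause_ca (\<alpha>s ! j))"
  shows "red (residuals \<alpha>s q) (residuals \<alpha>s (q[i := s, j := s']))"
proof -
  have "wf_clause (\<alpha>s ! j)" using wf ij by simp
  then obtain K r N where r: "residual (\<alpha>s ! j) (q ! j) = add_mset r K" "consume a r N"
      "residual (\<alpha>s ! j) s' = K + N"
    using j by (rule residual_request)
  have off: "residual (\<alpha>s ! i) (q ! i) = add_mset (Lit (Positive a)) (residual (\<alpha>s ! i) s)"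
    using residual_offer[OF _ i] wf ij by simp
  obtain R where R: "\<And>t. residuals \<alpha>s (q[i := t]) = R + residual (\<alpha>s ! i) t"
      "residuals \<alpha>s q = R + residual (\<alpha>s ! i) (q ! i)"
    using residuals_update[OF ij(2) len] by blast
  \<comment> \<open>\<open>S\<close> is taken after component \<open>i\<close> has moved. Comparing
    both expressions for the residuals of \<open>q[i := s]\<close> eliminates
    \<open>R\<close>.\<close>
  obtain S where S: "\<And>t. residuals \<alpha>s (q[i := s, j := t]) = S + residual (\<alpha>s ! j) t"
      "residuals \<alpha>s (q[i := s]) = S + residual (\<alpha>s ! j) (q[i := s] ! j)"
    using residuals_update[OF ij(3), of "q[i := s]"] len by auto
  have "residuals \<alpha>s q = (S + K) + {#Lit (Positive a), r#}"
    using R(1)[of s] R(2) S(2) off r ij by (simp add: ac_simps)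
  moreover have "residuals \<alpha>s (q[i := s, j := s']) = (S + K) + N"
    using S(1) r by (simp add: ac_simps)
  ultimately show ?thesis using red.intros[OF r(2)] by metis
qed

text \<open>A joint move is a reduction whichever partner makes the offer. A single move has only
  one active entry and is no match, so in an agreement it must be an offer, which spends one
  positive atom.\<close>

lemma step_red:
  assumes wf: "\<forall>\<alpha> \<in> set \<alpha>s. wf_clause \<alpha>" and t: "(q, v, q') \<in> ca_trans (clauses_ca \<alpha>s)"
    and v: "match_label v \<or> (\<exists>\<alpha>. offer_on \<alpha> v)"
  obtains (match) "red (residuals \<alpha>s q) (residuals \<alpha>s q')" "\<And>a. \<not> offer_on (Off a) v"
    | (offer) a where "residuals \<alpha>s q = add_mset (Lit (Positive a)) (residuals \<alpha>s q')"
        "\<And>b. offer_on (Off b) v \<longleftrightarrow> b = a"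
  using principal_clauses t
proof (cases rule: product_trans_cases)
  case (joint i j \<alpha> s r)
  then have len: "length q = length \<alpha>s" by (simp add: product_states[OF principal_clauses])
  from joint have "match_label v" using match_joint[of i j "length \<alpha>s" \<alpha>] by simp
  then have "\<not> offer_on (Off a) v" for a by (rule match_not_offer)
  moreover have "red (residuals \<alpha>s q) (residuals \<alpha>s q')"
  proof (cases \<alpha>)
    case (Req a)
    with joint len residuals_match[OF wf len, of j i a r s] show ?thesis
      by (simp add: list_update_swap)
  next
    case (Off a)
    with joint len residuals_match[OF wf len, of i j a s r] show ?thesis by simp
  qed (use joint in simp)
  ultimately show thesis using match by blast
next
  case (solo i \<alpha> s)
  then have len: "length q = length \<alpha>s" by (simp add: product_states[OF principal_clauses])
  from solo v have "\<exists>\<beta>. offer_on \<beta> v" using not_match_solo[of i "length \<alpha>s" \<alpha>] by auto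
  with solo obtain a where a: "\<alpha> = Off a" by (auto simp: offer_on_solo_iff)
  have "residual (\<alpha>s ! i) (q ! i) = add_mset (Lit (Positive a)) (residual (\<alpha>s ! i) s)"
    using residual_offer[of "\<alpha>s ! i" "q ! i" a s] wf solo a by simp
  moreover obtain R where "\<And>t. residuals \<alpha>s (q[i := t]) = R + residual (\<alpha>s ! i) t"
      "residuals \<alpha>s q = R + residual (\<alpha>s ! i) (q ! i)"
    using residuals_update[of i \<alpha>s q] len solo by auto
  ultimately have "residuals \<alpha>s q = add_mset (Lit (Positive a)) (residuals \<alpha>s q')"
    using solo by simp
  moreover have "offer_on (Off b) v \<longleftrightarrow> b = a" for b
    using solo a by (simp add: offer_on_solo_iff)
  ultimately show thesis using offer by blast
qed

text \<open>An offered atom leaves the automaton but stays in the configuration: the rest of the run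
  is reduced with this atom as an inert context. Offers may therefore occur anywhere in the run, and
  \<open>Z\<close> shrinks along the induction.\<close>

lemma reds_if_run:
  assumes "ca_path (clauses_ca \<alpha>s) q w q'" "\<forall>\<alpha> \<in> set \<alpha>s. wf_clause \<alpha>" "residuals \<alpha>s q' = {#}"
    and "\<forall>v \<in> set w. match_label v \<or> (\<exists>\<alpha>. offer_on \<alpha> v)"
    and "\<forall>a. length (filter (offer_on (Off a)) w) = count Z a"
  shows "red\<^sup>*\<^sup>* (residuals \<alpha>s q) (atoms Z)"
  using assms
proof (induction arbitrary: Z rule: ca_path.induct)
  case (path_Nil q)
  then have "Z = {#}" by (intro multiset_eqI) simp
  with path_Nil show ?case by simp
next
  case (path_Cons q v q' w q'')
  from path_Cons.prems have v: "match_label v \<or> (\<exists>\<alpha>. offer_on \<alpha> v)" by simp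
  from path_Cons.prems(1) path_Cons.hyps(1) v show ?case
  proof (cases rule: step_red)
    case match
    with path_Cons.prems have "red\<^sup>*\<^sup>* (residuals \<alpha>s q') (atoms Z)" by (intro path_Cons.IH) auto
    with match(1) show ?thesis by (rule converse_rtranclp_into_rtranclp)
  next
    case (offer a)
    from path_Cons.prems(4) have "length (filter (offer_on (Off a)) (v # w)) = count Z a" by blast
    with offer(2) have "a \<in># Z" by (auto simp flip: count_greater_zero_iff)
    then obtain Z' where Z: "Z = add_mset a Z'" by (metis insert_DiffM)
    have "\<forall>b. length (filter (offer_on (Off b)) w) = count Z' b"
    proof
      fix b
      from path_Cons.prems(4) have "length (filter (offer_on (Off b)) (v # w)) = count Z b" by blast
      then show "length (filter (offer_on (Off b)) w) = count Z' b"
        unfolding Z by (auto simp: offer(2) split: if_splits)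
    qed
    with path_Cons.prems have "red\<^sup>*\<^sup>* (residuals \<alpha>s q') (atoms Z')" by (intro path_Cons.IH) auto
    from reds_add_right[OF this, of "{#Lit (Positive a)#}"] show ?thesis
      using offer(1) Z by simp
  qed
qed

section \<open>From reductions back to runs\<close>

text \<open>A joint move is never blocked by third parties, so it suffices that the atom and its
  consumer sit in two different principals that can both move.\<close>

lemma match_if_red:
  assumes wf: "\<forall>\<alpha> \<in> set \<alpha>s. wf_clause \<alpha>" and q: "q \<in> ca_states (clauses_ca \<alpha>s)"
    and red: "red (residuals \<alpha>s q) M"
  obtains v q' where "(q, v, q') \<in> ca_trans (clauses_ca \<alpha>s)" "match_label v" "residuals \<alpha>s q' = M"
proof -
  from red obtain a r N K where K: "residuals \<alpha>s q = K + {#Lit (Positive a), r#}" "M = K + N"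
    and r: "consume a r N"
    by (auto elim: red.cases)
  have len: "length q = length \<alpha>s"
    and st: "\<And>k. k < length \<alpha>s \<Longrightarrow> [q ! k] \<in> ca_states (clause_ca (\<alpha>s ! k))"
    using q by (auto simp: product_states[OF principal_clauses])
  have "Lit (Positive a) \<in># residuals \<alpha>s q" "r \<in># residuals \<alpha>s q" using K by auto
  then obtain i j where i: "i < length \<alpha>s" "Lit (Positive a) \<in># residual (\<alpha>s ! i) (q ! i)"
    and j: "j < length \<alpha>s" "r \<in># residual (\<alpha>s ! j) (q ! j)"
    unfolding residuals_component by blast
  have wfi: "wf_clause (\<alpha>s ! i)" and wfj: "wf_clause (\<alpha>s ! j)" using wf i j by auto
  have ij: "i \<noteq> j" using offer_request_exclusive[OF wfi i(2)] j(2) r by auto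
  obtain s where s: "([q ! i], [Off a], [s]) \<in> ca_trans (clause_ca (\<alpha>s ! i))"
    using literal_possible[OF st[OF i(1)] i(2)] by auto
  obtain s' where s': "([q ! j], [Req a], [s']) \<in> ca_trans (clause_ca (\<alpha>s ! j))"
      "residual (\<alpha>s ! j) s' = residual (\<alpha>s ! j) (q ! j) - {#r#} + N"
    using request_possible[OF wfj st[OF j(1)] j(2) r] by blast
  let ?v = "(replicate (length \<alpha>s) Idle)[i := Off a, j := Req a]" and ?q' = "q[i := s, j := s']"
  have "(q, ?v, ?q') \<in> ca_trans (clauses_ca \<alpha>s)"
    using product_match[OF principal_clauses q, of i j "Off a" s s'] i j ij s s' by simp
  moreover have "match_label ?v" using match_joint[of i j "length \<alpha>s" "Off a"] i j ij by simp
  moreover have "residuals \<alpha>s ?q' = M"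
  proof -
    obtain R where R: "\<And>t. residuals \<alpha>s (q[i := t]) = R + residual (\<alpha>s ! i) t"
        "residuals \<alpha>s q = R + residual (\<alpha>s ! i) (q ! i)"
      using residuals_update[OF i(1) len] by blast
    obtain S where S: "\<And>t. residuals \<alpha>s (q[i := s, j := t]) = S + residual (\<alpha>s ! j) t"
        "residuals \<alpha>s (q[i := s]) = S + residual (\<alpha>s ! j) (q[i := s] ! j)"
      using residuals_update[OF j(1), of "q[i := s]"] len by auto
    obtain L where L: "residual (\<alpha>s ! j) (q ! j) = add_mset r L" using j(2) by (metis insert_DiffM)
    have "residuals \<alpha>s q = (S + L) + {#Lit (Positive a), r#}"
      using R(1)[of s] R(2) S(2) L ij residual_offer[OF wfi s] by simp
    with K(1) have "S + L = K" by simp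
    with S(1) s'(2) L K(2) show ?thesis by (auto simp: add.assoc)
  qed
  ultimately show thesis using that by blast
qed

text \<open>A single offer is blocked only by a complementary request elsewhere. An enabled request
  exhibits, by \<open>residual_request\<close>, a resource able to consume the atom, and positive
  atoms consume nothing.\<close>

lemma offer_if_atoms:
  assumes wf: "\<forall>\<alpha> \<in> set \<alpha>s. wf_clause \<alpha>" and q: "q \<in> ca_states (clauses_ca \<alpha>s)"
    and Z: "residuals \<alpha>s q = atoms (add_mset a Z)"
  obtains v q' where "(q, v, q') \<in> ca_trans (clauses_ca \<alpha>s)" "\<And>\<beta>. offer_on \<beta> v \<longleftrightarrow> \<beta> = Off a"
    "residuals \<alpha>s q' = atoms Z"
proof -
  have len: "length q = length \<alpha>s"
    and st: "\<And>k. k < length \<alpha>s \<Longrightarrow> [q ! k] \<in> ca_states (clause_ca (\<alpha>s ! k))"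
    using q by (auto simp: product_states[OF principal_clauses])
  have "Lit (Positive a) \<in># residuals \<alpha>s q" using Z by auto
  then obtain i where i: "i < length \<alpha>s" "Lit (Positive a) \<in># residual (\<alpha>s ! i) (q ! i)"
    unfolding residuals_component by blast
  have wfi: "wf_clause (\<alpha>s ! i)" using wf i by auto
  obtain s where s: "([q ! i], [Off a], [s]) \<in> ca_trans (clause_ca (\<alpha>s ! i))"
    using literal_possible[OF st[OF i(1)] i(2)] by auto
  have free: "([q ! j], [Req a], [s']) \<notin> ca_trans (clause_ca (\<alpha>s ! j))" if j: "j < length \<alpha>s" for j s'
  proof
    assume "([q ! j], [Req a], [s']) \<in> ca_trans (clause_ca (\<alpha>s ! j))"
    moreover have "wf_clause (\<alpha>s ! j)" using wf j by simp
    ultimately obtain K r N where r: "residual (\<alpha>s ! j) (q ! j) = add_mset r K" "consume a r N"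
      by (blast elim: residual_request)
    then have "r \<in># residuals \<alpha>s q" unfolding residuals_component using j by auto
    with Z r(2) show False by (auto elim: consume.cases)
  qed
  let ?v = "(replicate (length \<alpha>s) Idle)[i := Off a]"
  have "(q, ?v, q[i := s]) \<in> ca_trans (clauses_ca \<alpha>s)"
    using product_solo[OF principal_clauses q, of i "Off a" s] i s free by simp
  moreover have "offer_on \<beta> ?v \<longleftrightarrow> \<beta> = Off a" for \<beta> using i by (simp add: offer_on_solo_iff)
  moreover have "residuals \<alpha>s (q[i := s]) = atoms Z"
  proof -
    obtain R where "\<And>t. residuals \<alpha>s (q[i := t]) = R + residual (\<alpha>s ! i) t"
        "residuals \<alpha>s q = R + residual (\<alpha>s ! i) (q ! i)"
      using residuals_update[OF i(1) len] by blast
    with Z residual_offer[OF wfi s] show ?thesis by simp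
  qed
  ultimately show thesis using that by blast
qed

lemma run_if_atoms:
  assumes "\<forall>\<alpha> \<in> set \<alpha>s. wf_clause \<alpha>" "q \<in> ca_states (clauses_ca \<alpha>s)" "residuals \<alpha>s q = atoms Z"
  shows "\<exists>w q'. ca_path (clauses_ca \<alpha>s) q w q' \<and> q' \<in> ca_final (clauses_ca \<alpha>s) \<and>
    (\<forall>v \<in> set w. match_label v \<or> (\<exists>\<alpha>. offer_on \<alpha> v)) \<and>
    (\<forall>a. length (filter (offer_on (Off a)) w) = count Z a)"
  using assms(2,3)
proof (induction Z arbitrary: q)
  case empty
  then show ?case
    by (intro exI[of _ "[]"] exI[of _ q]) (auto simp: final_iff intro: path_Nil)
next
  case (add a Z)
  obtain v q' where v: "(q, v, q') \<in> ca_trans (clauses_ca \<alpha>s)" "\<And>\<beta>. offer_on \<beta> v \<longleftrightarrow> \<beta> = Off a"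
    "residuals \<alpha>s q' = atoms Z"
    using offer_if_atoms[OF assms(1) add.prems] by blast
  from add.IH[OF product_states_closed(2)[OF principal_clauses v(1)] v(3)]
  obtain w q'' where "ca_path (clauses_ca \<alpha>s) q' w q''" "q'' \<in> ca_final (clauses_ca \<alpha>s)"
    "\<forall>v \<in> set w. match_label v \<or> (\<exists>\<alpha>. offer_on \<alpha> v)"
    "\<forall>a. length (filter (offer_on (Off a)) w) = count Z a"
    by blast
  with v show ?case
    by (intro exI[of _ "v # w"] exI[of _ q'']) (auto intro: path_Cons)
qed

lemma run_if_reds:
  assumes wf: "\<forall>\<alpha> \<in> set \<alpha>s. wf_clause \<alpha>"
    and "q \<in> ca_states (clauses_ca \<alpha>s)" "red\<^sup>*\<^sup>* (residuals \<alpha>s q) (atoms Z)"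
  shows "\<exists>w q'. ca_path (clauses_ca \<alpha>s) q w q' \<and> q' \<in> ca_final (clauses_ca \<alpha>s) \<and>
    (\<forall>v \<in> set w. match_label v \<or> (\<exists>\<alpha>. offer_on \<alpha> v)) \<and>
    (\<forall>a. length (filter (offer_on (Off a)) w) = count Z a)"
  using assms(3,2)
proof (induction "residuals \<alpha>s q" arbitrary: q rule: converse_rtranclp_induct)
  case base
  then show ?case using run_if_atoms[OF wf] by metis
next
  case (step M)
  obtain v q' where v: "(q, v, q') \<in> ca_trans (clauses_ca \<alpha>s)" "match_label v" "residuals \<alpha>s q' = M"
    using match_if_red[OF wf step.prems step.hyps(1)] by blast
  from step.hyps(3)[OF v(3)[symmetric] product_states_closed(2)[OF principal_clauses v(1)]]
  obtain w q'' where "ca_path (clauses_ca \<alpha>s) q' w q''" "q'' \<in> ca_final (clauses_ca \<alpha>s)"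
    "\<forall>v \<in> set w. match_label v \<or> (\<exists>\<alpha>. offer_on \<alpha> v)"
    "\<forall>a. length (filter (offer_on (Off a)) w) = count Z a"
    by blast
  with v show ?case
    by (intro exI[of _ "v # w"] exI[of _ q'']) (auto intro: path_Cons dest: match_not_offer)
qed

lemma path_states:
  assumes "ca_path (clauses_ca \<alpha>s) q w q'"
  shows "q' \<in> ca_states (clauses_ca \<alpha>s)"
  using assms by induction auto

theorem agreement_iff_reds:
  assumes wf: "\<forall>\<alpha> \<in> set \<alpha>s. wf_clause \<alpha>"
  shows "admits_agreement (clauses_ca \<alpha>s) Z \<longleftrightarrow> red\<^sup>*\<^sup>* (clauses_resources \<alpha>s) (atoms (literals_of Z))"
proof
  assume "admits_agreement (clauses_ca \<alpha>s) Z"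
  then obtain w q where w: "ca_path (clauses_ca \<alpha>s) (ca_init (clauses_ca \<alpha>s)) w q" "q \<in> ca_final (clauses_ca \<alpha>s)"
    "\<forall>v \<in> set w. match_label v \<or> (\<exists>\<alpha>. offer_on \<alpha> v)"
    "\<forall>a. length (filter (offer_on (Off a)) w) = count (literals_of Z) a"
    unfolding admits_agreement_def ca_language_def by blast
  from w(2) have "residuals \<alpha>s q = {#}" by (simp add: final_iff path_states[OF w(1)])
  from reds_if_run[OF w(1) wf this w(3,4)] show "red\<^sup>*\<^sup>* (clauses_resources \<alpha>s) (atoms (literals_of Z))"
    by (simp add: residuals_init)
next
  assume "red\<^sup>*\<^sup>* (clauses_resources \<alpha>s) (atoms (literals_of Z))"
  then have "red\<^sup>*\<^sup>* (residuals \<alpha>s (ca_init (clauses_ca \<alpha>s))) (atoms (literals_of Z))"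
    by (simp only: residuals_init)
  from run_if_reds[OF wf init_state this] show "admits_agreement (clauses_ca \<alpha>s) Z"
    unfolding admits_agreement_def ca_language_def by blast
qed

lemma wf_clauses: "wf_horn p \<Longrightarrow> \<alpha> \<in> set (clauses p) \<Longrightarrow> wf_clause \<alpha>"
  by (cases p) auto

theorem theorem5p15:
  fixes \<Gamma> :: "'a horn multiset" and \<Gamma>s :: "'a horn list" and Z :: "'a form option"
  assumes "\<forall>p \<in># \<Gamma>. wf_horn p"
    and "pos_tensor_or_empty Z"
    and "mset \<Gamma>s = \<Gamma>"
  shows "honoured (image_mset horn_form \<Gamma>) Z \<longleftrightarrow> admits_agreement (horns_ca \<Gamma>s) Z"
proof -
  let ?\<alpha>s = "concat (map clauses \<Gamma>s)"
  have wf: "\<forall>p \<in> set \<Gamma>s. wf_horn p" using assms by auto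
  have forms: "image_mset horn_form \<Gamma> = mset (map horn_form \<Gamma>s)" using assms(3) by simp
  \<comment> \<open>The order of principals fixed by \<open>\<Gamma>s\<close> disappears, as only
    the sum of the clause resources remains. For the empty list the automaton accepts no word, in
    accordance with the unprovability of the empty context.\<close>
  have "admits_agreement (horns_ca \<Gamma>s) Z \<longleftrightarrow>
      \<Gamma>s \<noteq> [] \<and> red\<^sup>*\<^sup>* (clauses_resources ?\<alpha>s) (atoms (literals_of Z))"
  proof (cases "\<Gamma>s = []")
    case True
    then show ?thesis
      by (simp add: admits_agreement_def ca_language_def empty_ca_def)
  next
    case False
    have "\<forall>\<alpha> \<in> set ?\<alpha>s. wf_clause \<alpha>" using wf wf_clauses by auto
    from agreement_iff_reds[OF this] core_admits_agreement[OF core_horns_ca[OF False]] False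
    show ?thesis by simp
  qed
  then show ?thesis
    unfolding honoured_def forms provable_iff_reds[OF wf assms(2)] using assms(2) by blast
qed

end
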